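(* Let $\Delta>0$, $\mathbb T_\Delta=\{(t_1,t_2)\in\mathbb R_+^2: t_1-\Delta\le t_2\le t_1\}$, $d(\mathbf t,\mathbf s)=\max\{|t_1-s_1|,|t_2-s_2|\}$. Let $(b_l)_{l\ge0}$ be increasing with $b_0=0$, $b_{l+1}-b_l\ge1$, $b_l\to\infty$, and let $a(t)>0$ be a continuous increasing function, $a_l=a(b_l)$. Put $\mathbb T_l=\{(t_1,t_2)\in\mathbb R_+^2: b_l\le t_1\le b_{l+1},\ t_1-\Delta\le t_2\le t_1\}$. Assume $0<\Delta\le 2(b_{l+1}-b_l)$ for all $l\ge0$, and let $X=\{X(\mathbf t),\mathbf t\in\mathbb T_\Delta\}$ be a centered separable Gaussian process such that: (vi) $m_l:=\sup_{\mathbf t\in\mathbb T_l}\left(\mathbb E X(\mathbf t)^2\right)^{1/2}<\infty$ for all $l$; (vii) there exist $\beta\in(0,1]$ and $c_l>0$ with $\sup_{d(\mathbf t,\mathbf s)\le h,\ \mathbf t,\mathbf s\in\mathbb T_l}\left(\mathbb E(X(\mathbf t)-X(\mathbf s))^2\right)^{1/2}\le c_lh^\beta$ for all $h>0$, $l\ge0$; (viii) $A:=\sum_{l=0}^\infty\frac{m_l}{a_l}<\infty$, $\sum_{l=0}^\infty\frac{m_l\log(b_{l+1}-b_l)}{a_l}<\infty$, and for some $\gamma\in(0,1]$, $\sum_{l=0}^\infty\frac{m_l^{1-2\gamma/\beta}c_l^{2\gamma/\beta}}{a_l}<\infty$. Then for any $\theta\in(0,1)$, $\varepsilon\in(0,\beta)$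 and $\lambda>0$, \[ \mathbb E\exp\Big\{\lambda\sup_{\mathbf t\in\mathbb T_\Delta}\frac{|X(\mathbf t)|}{a(t_1)}\Big\}\le\exp\Big\{\frac{\lambda^2A^2}{2(1-\theta)^2}\Big\}A_6(\theta,\gamma,\varepsilon), \] where \[ A_6(\theta,\gamma,\varepsilon)=\frac{2^{\frac2\varepsilon+2}}{\Delta}\exp\Big\{\frac1A\sum_{l=0}^\infty\frac{m_l\log(b_{l+1}-b_l)}{a_l}\Big\}\exp\Big\{\frac{\Delta^{2\gamma}}{\gamma A(1-\frac\varepsilon\beta)^{2\gamma/\varepsilon}\theta^{2\gamma/\beta}4^{2\gamma}}\sum_{l=0}^\infty\frac{c_l^{2\gamma/\beta}m_l^{1-2\gamma/\beta}}{a_l}\Big\}. \] *)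

theory Defs
  imports "HOL-Probability.Probability"
begin

definition centered_gaussian_process ::
  "'a measure \<Rightarrow> 'i set \<Rightarrow> ('i \<Rightarrow> 'a \<Rightarrow> real) \<Rightarrow> bool" where
  "centered_gaussian_process M T X \<longleftrightarrow>
     prob_space M \<and> (\<forall>t\<in>T. X t \<in> borel_measurable M) \<and>
     (\<forall>F c. finite F \<and> F \<subseteq> T \<longrightarrow>
        ((\<exists>\<sigma>>0. distributed M lborel (\<lambda>\<omega>. \<Sum>t\<in>F. c t * X t \<omega>) (normal_density 0 \<sigma>))
         \<or> (AE \<omega> in M. (\<Sum>t\<in>F. c t * X t \<omega>) = 0)))"

text \<open>Separability in the sense of Doob: there is a countable separant S and a
  null set N outside of which every value X t is a limit of values along S.\<close>
definition separable_process ::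
  "'a measure \<Rightarrow> ('i::metric_space) set \<Rightarrow> ('i \<Rightarrow> 'a \<Rightarrow> real) \<Rightarrow> bool" where
  "separable_process M T X \<longleftrightarrow>
     (\<exists>S \<subseteq> T. countable S \<and> (\<exists>N \<in> null_sets M. \<forall>\<omega> \<in> space M - N. \<forall>t\<in>T.
        \<exists>s::nat \<Rightarrow> 'i. (\<forall>n. s n \<in> S) \<and> s \<longlonglongrightarrow> t \<and> (\<lambda>n. X (s n) \<omega>) \<longlonglongrightarrow> X t \<omega>))"

definition dmax :: "real \<times> real \<Rightarrow> real \<times> real \<Rightarrow> real" where
  "dmax t s = max \<bar>fst t - fst s\<bar> \<bar>snd t - snd s\<bar>"

definition TDelta :: "real \<Rightarrow> (real \<times> real) set" where
  "TDelta \<Delta> = {t. 0 \<le> fst t \<and> 0 \<le> snd t \<and> fst t - \<Delta> \<le> snd t \<and> snd t \<le> fst t}"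

definition Tblock :: "real \<Rightarrow> (nat \<Rightarrow> real) \<Rightarrow> nat \<Rightarrow> (real \<times> real) set" where
  "Tblock \<Delta> b l = {t. 0 \<le> fst t \<and> 0 \<le> snd t \<and> b l \<le> fst t \<and> fst t \<le> b (Suc l)
                      \<and> fst t - \<Delta> \<le> snd t \<and> snd t \<le> fst t}"

definition sd_sup :: "'a measure \<Rightarrow> ('i \<Rightarrow> 'a \<Rightarrow> real) \<Rightarrow> 'i set \<Rightarrow> real" where
  "sd_sup M X S = (SUP t\<in>S. sqrt (\<integral>\<omega>. (X t \<omega>)\<^sup>2 \<partial>M))"

text \<open>Real power with the convention 0^0 = 1 (x^p for x \<ge> 0).\<close>
definition rpow :: "real \<Rightarrow> real \<Rightarrow> real" where
  "rpow x p = (if p = 0 then 1 else x powr p)"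

end

theory Submission
  imports Defs
begin

text \<open>
  The weighted supremum is at most the sum over the blocks of \<open>sup |X| / a\<^sub>l\<close>, and the blocks are combined
  by Hoelder's inequality (in the form of convexity of \<open>exp\<close>) with weights \<open>m\<^sub>l / (a\<^sub>l A)\<close>. A single
  block is handled by chaining along nets of standard-deviation radius \<open>\<theta>\<^sup>k m\<close>, combined by
  Hoelder's inequality with weights \<open>(1 - \<theta>) \<theta>\<^sup>k\<close>: these make every level contribute the same
  exponent \<open>\<lambda>\<^sup>2 / (2 (1 - \<theta>)\<^sup>2)\<close>. The parameter \<open>\<epsilon>\<close> enters when the weighted entropy
  \<open>\<Sum>w\<^sub>k ln (1 + y\<^sub>k)\<close> is bounded using \<open>\<epsilon> ln (1 + y) \<le> ln (1 + y powr \<epsilon>)\<close> and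
  Jensen's inequality: \<open>\<Sum>w\<^sub>k y\<^sub>k powr \<epsilon>\<close> is a convergent geometric sum exactly for \<open>\<epsilon> < \<beta>\<close>.
\<close>

subsection \<open>Exponential moments\<close>

text \<open>Jensen's inequality for \<open>exp\<close> with weights that may fall short of 1: the
  missing mass sits at the point 0, where \<open>exp\<close> is 1. Finite partial sums of the
  Hoelder weights are of this kind.\<close>

lemma exp_weighted_sum_le:
  fixes w z :: "'i \<Rightarrow> real"
  assumes "\<And>i. i \<in> I \<Longrightarrow> 0 \<le> w i" and "sum w I \<le> 1"
  shows "exp (\<Sum>i\<in>I. w i * z i) \<le> (\<Sum>i\<in>I. w i * exp (z i)) + (1 - sum w I)"
proof -
  define s where "s = (\<Sum>i\<in>I. w i * z i)"
  \<comment> \<open>The convex function lies above its tangent at \<open>s\<close>, which is still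
    the mean once the missing mass is put at 0.\<close>
  have tangent: "exp s * (1 + (y - s)) \<le> exp y" for y
    using mult_left_mono[OF exp_ge_add_one_self[of "y - s"], of "exp s"]
    by (simp flip: exp_add)
  have "exp s * (1 + (0 - s)) * (1 - sum w I) \<le> exp 0 * (1 - sum w I)"
    using assms(2) by (intro mult_right_mono tangent) simp
  moreover have "(\<Sum>i\<in>I. w i * (exp s * (1 + (z i - s)))) \<le> (\<Sum>i\<in>I. w i * exp (z i))"
    by (intro sum_mono mult_left_mono tangent assms)
  moreover have "(\<Sum>i\<in>I. w i * (exp s * (1 + (z i - s)))) = exp s * (sum w I * (1 - s) + s)"
  proof -
    have "(\<Sum>i\<in>I. w i * (exp s * (1 + (z i - s)))) = (\<Sum>i\<in>I. exp s * (1 - s) * w i + exp s * (w i * z i))"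
      by (simp add: algebra_simps)
    also have "\<dots> = exp s * (1 - s) * sum w I + exp s * s"
      by (simp add: sum.distrib s_def flip: sum_distrib_left)
    finally show ?thesis by (simp add: algebra_simps)
  qed
  ultimately show ?thesis
    unfolding s_def[symmetric] by (simp add: algebra_simps)
qed

text \<open>Hoelder's inequality for finitely many exponentials. Division by
  \<open>exp (C i)\<close> gives every factor mean at most 1; Jensen's inequality then applies
  pointwise, and integrating it leaves a total mass of at most 1.\<close>

lemma nn_integral_exp_weighted_sum_le:
  fixes w C :: "'i \<Rightarrow> real" and Y :: "'i \<Rightarrow> 'w \<Rightarrow> real"
  assumes "prob_space M"
    and fin: "finite I" and w: "\<And>i. i \<in> I \<Longrightarrow> 0 \<le> w i" "sum w I \<le> 1"
    and meas: "\<And>i. i \<in> I \<Longrightarrow> Y i \<in> borel_measurable M"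
    and bound: "\<And>i. i \<in> I \<Longrightarrow> (\<integral>\<^sup>+\<omega>. ennreal (exp (Y i \<omega>)) \<partial>M) \<le> ennreal (exp (C i))"
  shows "(\<integral>\<^sup>+\<omega>. ennreal (exp (\<Sum>i\<in>I. w i * Y i \<omega>)) \<partial>M) \<le> ennreal (exp (\<Sum>i\<in>I. w i * C i))"
proof -
  interpret prob_space M by fact
  let ?c = "\<Sum>i\<in>I. w i * C i"
  have pw: "exp (\<Sum>i\<in>I. w i * Y i \<omega>) \<le>
      exp ?c * (1 - sum w I) + (\<Sum>i\<in>I. (exp ?c * w i * exp (- C i)) * exp (Y i \<omega>))" for \<omega>
  proof -
    have "exp (\<Sum>i\<in>I. w i * Y i \<omega>) = exp ?c * exp (\<Sum>i\<in>I. w i * (Y i \<omega> - C i))"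
      by (simp flip: exp_add add: algebra_simps sum_subtractf)
    also have "\<dots> \<le> exp ?c * ((\<Sum>i\<in>I. w i * exp (Y i \<omega> - C i)) + (1 - sum w I))"
      by (intro mult_left_mono exp_weighted_sum_le w) auto
    finally show ?thesis
      by (simp add: algebra_simps sum_distrib_left exp_diff exp_minus divide_simps)
  qed
  have "(\<integral>\<^sup>+\<omega>. ennreal (exp (\<Sum>i\<in>I. w i * Y i \<omega>)) \<partial>M)
     \<le> (\<integral>\<^sup>+\<omega>. ennreal (exp ?c * (1 - sum w I)) + (\<Sum>i\<in>I. ennreal (exp ?c * w i * exp (- C i)) * ennreal (exp (Y i \<omega>))) \<partial>M)"
    using w pw
    by (intro nn_integral_mono)
       (simp flip: ennreal_mult' ennreal_plus add: sum_ennreal sum_nonneg ennreal_leI)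
  also have "\<dots> = ennreal (exp ?c * (1 - sum w I)) +
      (\<Sum>i\<in>I. ennreal (exp ?c * w i * exp (- C i)) * (\<integral>\<^sup>+\<omega>. ennreal (exp (Y i \<omega>)) \<partial>M))"
    using meas
    by (subst nn_integral_add)
       (auto simp: nn_integral_sum nn_integral_cmult emeasure_space_1 intro!: borel_measurable_sum)
  also have "\<dots> \<le> ennreal (exp ?c * (1 - sum w I)) +
      (\<Sum>i\<in>I. ennreal (exp ?c * w i * exp (- C i)) * ennreal (exp (C i)))"
    by (intro add_mono sum_mono mult_left_mono bound) auto
  also have "\<dots> = ennreal (exp ?c * (1 - sum w I) + (\<Sum>i\<in>I. exp ?c * w i))"
    using w by (simp flip: ennreal_mult' ennreal_plus add: sum_ennreal sum_nonneg mult.assoc exp_minus)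
  also have "exp ?c * (1 - sum w I) + (\<Sum>i\<in>I. exp ?c * w i) = exp ?c"
    using sum_distrib_left[of "exp ?c" w I] by (simp add: right_diff_distrib)
  finally show ?thesis .
qed

section \<open>Elementary inequalities for powers and logarithms\<close>

text \<open>Numbers in the unit interval only grow under a power \<open>p \<le> 1\<close>; this is
  applied to the two fractions of \<open>1 + z\<close>, which sum to 1.\<close>

lemma powr_one_plus_le:
  fixes p z :: real
  assumes "0 < p" "p \<le> 1" "0 < z"
  shows "(1 + z) powr p \<le> 1 + z powr p"
proof -
  let ?s = "1 + z"
  have "1 / ?s \<le> (1 / ?s) powr p" "z / ?s \<le> (z / ?s) powr p"
    using assms powr_mono'[of p 1 "1 / ?s"] powr_mono'[of p 1 "z / ?s"] by auto
  moreover have "1 / ?s + z / ?s = 1"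
    using assms by (simp add: field_simps)
  ultimately have "1 \<le> (1 / ?s) powr p + (z / ?s) powr p" by linarith
  then show ?thesis
    using assms by (simp add: powr_divide field_simps)
qed

lemma powr_one_plus_le_convex:
  fixes p z :: real
  assumes "1 \<le> p" "0 < z"
  shows "(1 + z) powr p \<le> 2 powr (p - 1) * (1 + z powr p)"
proof -
  have "((1/2) *\<^sub>R 1 + (1/2) *\<^sub>R z) powr p \<le> (1/2) * (1 powr p) + (1/2) * z powr p"
    using convex_onD[OF powr_convex, of p "1/2" 1 z] assms by simp
  then have "((1 + z) / 2) powr p \<le> (1 + z powr p) / 2"
    by (simp add: add_divide_distrib)
  then show ?thesis
    using assms by (simp add: powr_divide powr_diff field_simps)
qed

text \<open>This turns an entropy logarithm into a power of the kind controlled by the third series.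
  The power \<open>?p\<close> of \<open>1 + z\<close> is compared with \<open>1 + z powr ?p\<close>:
  by subadditivity if \<open>?p \<le> 1\<close>, otherwise by midpoint convexity, which costs a
  power of 2.\<close>

lemma ln_one_plus_le_powr:
  fixes \<gamma> \<epsilon> z :: real
  assumes "0 < \<gamma>" "\<gamma> \<le> 1" "0 < \<epsilon>" "\<epsilon> \<le> 1" "0 < z"
  shows "2 / \<epsilon> * ln (1 + z) \<le> (2 / \<epsilon> - 1) * ln 2 + z powr (2 * \<gamma> / \<epsilon>) / \<gamma>"
proof -
  let ?p = "2 * \<gamma> / \<epsilon>"
  have p: "?p > 0" using assms by simp
  have "?p * ln (1 + z) \<le> \<gamma> * (2 / \<epsilon> - 1) * ln 2 + ln (1 + z powr ?p)"
  proof (cases "?p \<le> 1")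
    case True
    have "?p * ln (1 + z) = ln ((1 + z) powr ?p)"
      using assms by (simp add: ln_powr)
    also have "\<dots> \<le> ln (1 + z powr ?p)"
      using powr_one_plus_le[OF p True \<open>0 < z\<close>] assms by (intro ln_mono) auto
    finally have "?p * ln (1 + z) \<le> ln (1 + z powr ?p)" .
    moreover have "\<gamma> * (2 / \<epsilon> - 1) * ln 2 \<ge> 0"
      using assms by (intro mult_nonneg_nonneg) (auto simp: field_simps)
    ultimately show ?thesis by linarith
  next
    case False
    have "?p * ln (1 + z) = ln ((1 + z) powr ?p)"
      using assms by (simp add: ln_powr)
    also have "\<dots> \<le> ln (2 powr (?p - 1) * (1 + z powr ?p))"
      using powr_one_plus_le_convex[of ?p z] False assms by (intro ln_mono) auto
    also have "\<dots> = (?p - 1) * ln 2 + ln (1 + z powr ?p)"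
      using assms by (subst ln_mult) (auto simp: add_nonneg_eq_0_iff ln_powr)
    \<comment> \<open>Here \<open>\<gamma> \<le> 1\<close> enters: the two sides differ by
      \<open>(1 - \<gamma>) * ln 2\<close>.\<close>
    also have "(?p - 1) * ln 2 \<le> \<gamma> * (2 / \<epsilon> - 1) * ln 2"
      using assms by (intro mult_right_mono) (auto simp: field_simps)
    finally show ?thesis by simp
  qed
  also have "ln (1 + z powr ?p) \<le> z powr ?p"
    using assms by (intro ln_add_one_self_le_self) simp
  finally have "?p * ln (1 + z) / \<gamma> \<le> (\<gamma> * (2 / \<epsilon> - 1) * ln 2 + z powr ?p) / \<gamma>"
    using assms by (intro divide_right_mono) auto
  then show ?thesis
    using assms by (simp add: add_divide_distrib)
qed

text \<open>The terms are geometric with ratio \<open>\<theta> powr (1 - r)\<close>, so everything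
  rests on bounding \<open>(1 - \<theta>) / (1 - q)\<close> independently of \<theta>.\<close>

lemma geometric_weighted_powr_sum_le:
  fixes \<theta> r :: real
  assumes "0 < \<theta>" "\<theta> < 1" "0 < r" "r < 1"
  shows "(\<Sum>k<n. (1 - \<theta>) * \<theta> ^ k * (\<theta> ^ k) powr (- r)) \<le> 1 / (1 - r)"
proof -
  define q where "q = \<theta> powr (1 - r)"
  have q: "0 < q" "q < 1"
    using assms powr_less_mono'[of \<theta> 0 "1 - r"] by (auto simp: q_def)
  have eq: "\<theta> ^ k * (\<theta> ^ k) powr (- r) = q ^ k" for k
  proof -
    have "\<theta> ^ k * (\<theta> ^ k) powr (- r) = (\<theta> ^ k) powr (1 - r)"
      using assms powr_add[of "\<theta> ^ k" 1 "- r"] by simp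
    also have "\<dots> = q ^ k"
      using assms by (simp add: q_def powr_powr powr_power mult.commute flip: powr_realpow)
    finally show ?thesis .
  qed
  \<comment> \<open>Jensen's inequality with a single index of weight \<open>1 - r\<close>; the
    missing mass \<open>r\<close> at 0 yields the constant term of the chord bound on
    \<open>q\<close>.\<close>
  have "exp (\<Sum>i\<in>{()}. (1 - r) * ln \<theta>) \<le> (\<Sum>i\<in>{()}. (1 - r) * exp (ln \<theta>)) + (1 - (\<Sum>i\<in>{()}. (1 - r)))"
    using assms by (intro exp_weighted_sum_le) auto
  then have "q \<le> (1 - r) * \<theta> + r"
    using assms by (simp add: q_def powr_def)
  then have "(1 - \<theta>) * (1 - r) \<le> 1 - q" by (simp add: algebra_simps)
  moreover have "(\<Sum>k<n. (1 - \<theta>) * \<theta> ^ k * (\<theta> ^ k) powr (- r)) = (1 - \<theta>) * ((1 - q ^ n) / (1 - q))"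
    using q by (simp add: eq mult.assoc sum_gp_strict flip: sum_distrib_left)
  moreover have "(1 - \<theta>) * ((1 - q ^ n) / (1 - q)) \<le> (1 - \<theta>) * (1 / (1 - q))"
    using q assms by (intro mult_left_mono divide_right_mono) auto
  moreover have "(1 - \<theta>) * (1 / (1 - q)) \<le> 1 / (1 - r)"
    using \<open>(1 - \<theta>) * (1 - r) \<le> 1 - q\<close> q assms by (simp add: field_simps)
  ultimately show ?thesis by linarith
qed

section \<open>Exponential moments of Gaussian variables\<close>

lemma nn_integral_exp_normal:
  assumes D: "distributed M lborel Y (normal_density 0 \<sigma>)" and "\<sigma> > 0"
  shows "(\<integral>\<^sup>+\<omega>. ennreal (exp (u * Y \<omega>)) \<partial>M) = ennreal (exp (u\<^sup>2 * \<sigma>\<^sup>2 / 2))"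
proof -
  have "normal_density 0 \<sigma> x * exp (u * x) = exp (u\<^sup>2 * \<sigma>\<^sup>2 / 2) * normal_density (u * \<sigma>\<^sup>2) \<sigma> x" for x
  proof -
    \<comment> \<open>Completing the square: the exponential tilt moves the mean to
      \<open>u * \<sigma>\<^sup>2\<close>.\<close>
    have "- x\<^sup>2 / (2 * \<sigma>\<^sup>2) + u * x = u\<^sup>2 * \<sigma>\<^sup>2 / 2 + - (x - u * \<sigma>\<^sup>2)\<^sup>2 / (2 * \<sigma>\<^sup>2)"
      using \<open>\<sigma> > 0\<close> by (simp add: field_simps power2_eq_square)
    then have "exp (- x\<^sup>2 / (2 * \<sigma>\<^sup>2)) * exp (u * x)
        = exp (u\<^sup>2 * \<sigma>\<^sup>2 / 2) * exp (- (x - u * \<sigma>\<^sup>2)\<^sup>2 / (2 * \<sigma>\<^sup>2))"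
      by (simp flip: exp_add)
    then show ?thesis by (simp add: normal_density_def)
  qed
  then have "(\<integral>\<^sup>+x. ennreal (normal_density 0 \<sigma> x) * ennreal (exp (u * x)) \<partial>lborel)
      = (\<integral>\<^sup>+x. ennreal (exp (u\<^sup>2 * \<sigma>\<^sup>2 / 2)) * ennreal (normal_density (u * \<sigma>\<^sup>2) \<sigma> x) \<partial>lborel)"
    by (simp flip: ennreal_mult')
  also have "\<dots> = ennreal (exp (u\<^sup>2 * \<sigma>\<^sup>2 / 2)) * 1"
    using \<open>\<sigma> > 0\<close> by (simp add: nn_integral_cmult nn_integral_eq_integral)
  finally show ?thesis
    using distributed_nn_integral[OF D, of "\<lambda>x. ennreal (exp (u * x))"] by simp
qed

text \<open>The exponential of an absolute value is at most the sum of the exponentials for both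
  signs, which have the same bound by symmetry; hence the factor 2. In the degenerate case each of
  the two integrals is 1.\<close>

lemma nn_integral_exp_abs_gaussian_le:
  fixes Y :: "'w \<Rightarrow> real"
  assumes "prob_space M" and meas: "Y \<in> borel_measurable M"
    and gauss: "(\<exists>\<sigma>>0. distributed M lborel Y (normal_density 0 \<sigma>)) \<or> (AE \<omega> in M. Y \<omega> = 0)"
    and sd: "sqrt (\<integral>\<omega>. (Y \<omega>)\<^sup>2 \<partial>M) \<le> v"
  shows "(\<integral>\<^sup>+\<omega>. ennreal (exp (u * \<bar>Y \<omega>\<bar>)) \<partial>M) \<le> ennreal (2 * exp (u\<^sup>2 * v\<^sup>2 / 2))"
proof -
  interpret prob_space M by fact
  have one: "(\<integral>\<^sup>+\<omega>. ennreal (exp (x * Y \<omega>)) \<partial>M) \<le> ennreal (exp (x\<^sup>2 * v\<^sup>2 / 2))" for x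
    using gauss
  proof
    assume "\<exists>\<sigma>>0. distributed M lborel Y (normal_density 0 \<sigma>)"
    then obtain \<sigma> where \<sigma>: "\<sigma> > 0" and D: "distributed M lborel Y (normal_density 0 \<sigma>)" by blast
    have "(\<integral>\<omega>. (Y \<omega>)\<^sup>2 \<partial>M) = \<sigma>\<^sup>2"
      using normal_distributed_variance[OF \<sigma> D] normal_distributed_expectation[OF \<sigma> D] by simp
    with sd \<sigma> have "\<sigma>\<^sup>2 \<le> v\<^sup>2" by (intro power_mono) auto
    then show ?thesis
      unfolding nn_integral_exp_normal[OF D \<sigma>]
      by (intro ennreal_leI) (simp add: mult_left_mono)
  next
    assume "AE \<omega> in M. Y \<omega> = 0"
    then have "(\<integral>\<^sup>+\<omega>. ennreal (exp (x * Y \<omega>)) \<partial>M) = (\<integral>\<^sup>+\<omega>. 1 \<partial>M)"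
      by (intro nn_integral_cong_AE) auto
    also have "\<dots> \<le> ennreal (exp (x\<^sup>2 * v\<^sup>2 / 2))"
      by (simp add: emeasure_space_1)
    finally show ?thesis .
  qed
  have "(\<integral>\<^sup>+\<omega>. ennreal (exp (u * \<bar>Y \<omega>\<bar>)) \<partial>M)
      \<le> (\<integral>\<^sup>+\<omega>. ennreal (exp (u * Y \<omega>)) + ennreal (exp (- u * Y \<omega>)) \<partial>M)"
    by (intro nn_integral_mono) (auto simp: abs_if simp flip: ennreal_plus)
  also have "\<dots> = (\<integral>\<^sup>+\<omega>. ennreal (exp (u * Y \<omega>)) \<partial>M) + (\<integral>\<^sup>+\<omega>. ennreal (exp (- u * Y \<omega>)) \<partial>M)"
    using meas by (intro nn_integral_add) auto
  also have "\<dots> \<le> ennreal (exp (u\<^sup>2 * v\<^sup>2 / 2)) + ennreal (exp ((- u)\<^sup>2 * v\<^sup>2 / 2))"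
    by (intro add_mono one)
  finally show ?thesis by (simp flip: ennreal_plus)
qed

text \<open>The maximum is traded for a sum over the finite set. The logarithm of the resulting
  cardinality is the entropy term of the chaining.\<close>

lemma nn_integral_exp_Max_gaussian_le:
  fixes Y :: "'j \<Rightarrow> 'w \<Rightarrow> real"
  assumes M: "prob_space M" and J: "finite J" "J \<noteq> {}" and "u \<ge> 0"
    and meas: "\<And>j. j \<in> J \<Longrightarrow> Y j \<in> borel_measurable M"
    and gauss: "\<And>j. j \<in> J \<Longrightarrow>
        (\<exists>\<sigma>>0. distributed M lborel (Y j) (normal_density 0 \<sigma>)) \<or> (AE \<omega> in M. Y j \<omega> = 0)"
    and sd: "\<And>j. j \<in> J \<Longrightarrow> sqrt (\<integral>\<omega>. (Y j \<omega>)\<^sup>2 \<partial>M) \<le> v"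
  shows "(\<integral>\<^sup>+\<omega>. ennreal (exp (u * (MAX j\<in>J. \<bar>Y j \<omega>\<bar>))) \<partial>M)
    \<le> ennreal (2 * real (card J) * exp (u\<^sup>2 * v\<^sup>2 / 2))"
proof -
  have "exp (u * (MAX j\<in>J. \<bar>Y j \<omega>\<bar>)) \<le> (\<Sum>j\<in>J. exp (u * \<bar>Y j \<omega>\<bar>))" for \<omega>
  proof -
    have "(MAX j\<in>J. \<bar>Y j \<omega>\<bar>) \<in> (\<lambda>j. \<bar>Y j \<omega>\<bar>) ` J"
      using J by (intro Max_in) auto
    then obtain j where j: "j \<in> J" "(MAX j\<in>J. \<bar>Y j \<omega>\<bar>) = \<bar>Y j \<omega>\<bar>" by auto
    show ?thesis
      using J unfolding j(2) by (intro member_le_sum[OF j(1), where f = "\<lambda>j. exp (u * \<bar>Y j \<omega>\<bar>)"]) auto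
  qed
  then have "(\<integral>\<^sup>+\<omega>. ennreal (exp (u * (MAX j\<in>J. \<bar>Y j \<omega>\<bar>))) \<partial>M)
      \<le> (\<integral>\<^sup>+\<omega>. (\<Sum>j\<in>J. ennreal (exp (u * \<bar>Y j \<omega>\<bar>))) \<partial>M)"
    by (intro nn_integral_mono) (simp add: sum_ennreal ennreal_leI)
  also have "\<dots> = (\<Sum>j\<in>J. \<integral>\<^sup>+\<omega>. ennreal (exp (u * \<bar>Y j \<omega>\<bar>)) \<partial>M)"
    using meas by (intro nn_integral_sum) auto
  also have "\<dots> \<le> (\<Sum>j\<in>J. ennreal (2 * exp (u\<^sup>2 * v\<^sup>2 / 2)))"
    by (intro sum_mono nn_integral_exp_abs_gaussian_le M meas gauss sd)
  also have "\<dots> = ennreal (2 * real (card J) * exp (u\<^sup>2 * v\<^sup>2 / 2))"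
    by (simp add: ennreal_of_nat_eq_real_of_nat mult_ac flip: ennreal_mult')
  finally show ?thesis .
qed

subsection \<open>Gaussian chaining\<close>

lemma gaussian_process_value:
  assumes "centered_gaussian_process M T X" "t \<in> T"
  shows "(\<exists>\<sigma>>0. distributed M lborel (X t) (normal_density 0 \<sigma>)) \<or> (AE \<omega> in M. X t \<omega> = 0)"
proof -
  have "\<forall>F c. finite F \<and> F \<subseteq> T \<longrightarrow>
        ((\<exists>\<sigma>>0. distributed M lborel (\<lambda>\<omega>. \<Sum>t\<in>F. c t * X t \<omega>) (normal_density 0 \<sigma>))
         \<or> (AE \<omega> in M. (\<Sum>t\<in>F. c t * X t \<omega>) = 0))"
    using assms by (simp add: centered_gaussian_process_def)
  from this[rule_format, of "{t}" "\<lambda>_. 1"] show ?thesis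
    using assms by simp
qed

lemma gaussian_process_diff:
  assumes "centered_gaussian_process M T X" "t \<in> T" "s \<in> T"
  shows "(\<exists>\<sigma>>0. distributed M lborel (\<lambda>\<omega>. X t \<omega> - X s \<omega>) (normal_density 0 \<sigma>))
    \<or> (AE \<omega> in M. X t \<omega> - X s \<omega> = 0)"
proof (cases "t = s")
  case False
  have "\<forall>F c. finite F \<and> F \<subseteq> T \<longrightarrow>
        ((\<exists>\<sigma>>0. distributed M lborel (\<lambda>\<omega>. \<Sum>t\<in>F. c t * X t \<omega>) (normal_density 0 \<sigma>))
         \<or> (AE \<omega> in M. (\<Sum>t\<in>F. c t * X t \<omega>) = 0))"
    using assms by (simp add: centered_gaussian_process_def)
  from this[rule_format, of "{t, s}" "\<lambda>r. if r = t then 1 else - 1"] show ?thesis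
    using assms False by simp
qed simp

text \<open>For the blocks with \<open>m l = 0\<close>. The Bochner integral is also 0 when the
  square is not integrable, so the Gaussian alternative is what excludes that case: a nondegenerate
  normal law has second moment \<open>\<sigma>\<^sup>2 > 0\<close>.\<close>

lemma gaussian_AE_zero:
  assumes "prob_space M"
    and "(\<exists>\<sigma>>0. distributed M lborel Y (normal_density 0 \<sigma>)) \<or> (AE \<omega> in M. Y \<omega> = 0)"
    and "sqrt (\<integral>\<omega>. (Y \<omega>)\<^sup>2 \<partial>M) \<le> 0"
  shows "AE \<omega> in M. Y \<omega> = 0"
proof -
  interpret prob_space M by fact
  have False if \<sigma>: "\<sigma> > 0" and D: "distributed M lborel Y (normal_density 0 \<sigma>)" for \<sigma>
  proof -
    have "(\<integral>\<omega>. (Y \<omega>)\<^sup>2 \<partial>M) = \<sigma>\<^sup>2"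
      using normal_distributed_variance[OF \<sigma> D] normal_distributed_expectation[OF \<sigma> D] by simp
    with assms(3) \<sigma> show False by simp
  qed
  with assms(2) show ?thesis by blast
qed

text \<open>The chain starts at level \<open>n\<close> from the finite set \<open>F\<close> itself
  and descends through the nets. \<open>F\<close> receives the mass \<open>\<theta> ^ n\<close> left
  over by the geometric weights, so its entropy term vanishes as \<open>n\<close> grows. Net
  \<open>k\<close> has radius \<open>\<theta> ^ Suc k * m\<close> because it serves the increments
  of level \<open>k + 1\<close>; level 0 is the process itself, with deviation at most
  \<open>m\<close>.\<close>

lemma gaussian_chaining_bound:
  fixes X :: "'i \<Rightarrow> 'w \<Rightarrow> real" and N :: "nat \<Rightarrow> 'i set"
  assumes gauss: "centered_gaussian_process M T X" and "S \<subseteq> T"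
    and m: "m > 0" and sd: "\<And>t. t \<in> S \<Longrightarrow> sqrt (\<integral>\<omega>. (X t \<omega>)\<^sup>2 \<partial>M) \<le> m"
    and \<theta>: "0 < \<theta>" "\<theta> < 1"
    and N: "\<And>k. finite (N k)" "\<And>k. N k \<noteq> {}" "\<And>k. N k \<subseteq> S"
    and net: "\<And>k t. t \<in> S \<Longrightarrow>
        \<exists>s\<in>N k. sqrt (\<integral>\<omega>. (X t \<omega> - X s \<omega>)\<^sup>2 \<partial>M) \<le> \<theta> ^ Suc k * m"
    and F: "finite F" "F \<noteq> {}" "F \<subseteq> S" and u: "u \<ge> 0"
  shows "(\<integral>\<^sup>+\<omega>. ennreal (exp (u / m * (MAX t\<in>F. \<bar>X t \<omega>\<bar>))) \<partial>M)
    \<le> ennreal (exp (u\<^sup>2 / (2 * (1 - \<theta>)\<^sup>2)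
         + (\<Sum>k<n. (1 - \<theta>) * \<theta> ^ k * ln (2 * real (card (N k)))) + \<theta> ^ n * ln (2 * real (card F))))"
proof -
  have M: "prob_space M" and meas: "\<And>t. t \<in> T \<Longrightarrow> X t \<in> borel_measurable M"
    using gauss unfolding centered_gaussian_process_def by blast+
  define \<pi> where "\<pi> k t = (SOME s. s \<in> N k \<and>
      sqrt (\<integral>\<omega>. (X t \<omega> - X s \<omega>)\<^sup>2 \<partial>M) \<le> \<theta> ^ Suc k * m)" for k t
  have \<pi>: "\<pi> k t \<in> N k"
      "sqrt (\<integral>\<omega>. (X t \<omega> - X (\<pi> k t) \<omega>)\<^sup>2 \<partial>M) \<le> \<theta> ^ Suc k * m" if "t \<in> S" for k t
    using someI_ex[OF net[OF that, of k, unfolded Bex_def]] unfolding \<pi>_def by blast+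
  define J where "J k = (if k < n then N k else F)" for k
  define V where "V k j = (if k = 0 then X j else (\<lambda>\<omega>. X j \<omega> - X (\<pi> (k - 1) j) \<omega>))" for k j
  define G where "G k \<omega> = (MAX j\<in>J k. \<bar>V k j \<omega>\<bar>)" for k \<omega>
  define w where "w k = (if k < n then (1 - \<theta>) * \<theta> ^ k else \<theta> ^ n)" for k
  \<comment> \<open>Logarithm of the bound for level \<open>k\<close>. The second summand is the
    same on all levels, hence survives averaging with weights of sum 1.\<close>
  define C where "C k = ln (2 * real (card (J k))) + u\<^sup>2 / (2 * (1 - \<theta>)\<^sup>2)" for k
  have J: "finite (J k)" "J k \<noteq> {}" "J k \<subseteq> S" for k
    using N F by (auto simp: J_def)
  have JT: "j \<in> T" "\<pi> k j \<in> T" if "j \<in> J i" for i j k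
    using J(3)[of i] that \<open>S \<subseteq> T\<close> \<pi>(1)[of j k] N(3)[of k] by auto
  have V_meas: "V k j \<in> borel_measurable M" if "j \<in> J k" for k j
    using meas JT[OF that] by (auto simp: V_def)
  have V_gauss: "(\<exists>\<sigma>>0. distributed M lborel (V k j) (normal_density 0 \<sigma>)) \<or> (AE \<omega> in M. V k j \<omega> = 0)"
    if "j \<in> J k" for k j
    using gaussian_process_value[OF gauss] gaussian_process_diff[OF gauss] JT[OF that]
    by (simp add: V_def)
  have V_sd: "sqrt (\<integral>\<omega>. (V k j \<omega>)\<^sup>2 \<partial>M) \<le> \<theta> ^ k * m" if "j \<in> J k" for k j
  proof -
    have "j \<in> S" using that J(3) by blast
    then show ?thesis
      using sd[of j] \<pi>(2)[of j "k - 1"] by (cases k) (auto simp: V_def)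
  qed
  have w_pos: "w k > 0" for k
    using \<theta> by (simp add: w_def)
  have sum_le_n: "(\<Sum>k\<le>n. f (w k) (J k) k) = (\<Sum>k<n. f ((1 - \<theta>) * \<theta> ^ k) (N k) k) + f (\<theta> ^ n) F n"
    for f :: "real \<Rightarrow> 'i set \<Rightarrow> nat \<Rightarrow> real"
    by (simp add: w_def J_def flip: lessThan_Suc_atMost)
  have "(\<Sum>k<n. \<theta> ^ k) * (1 - \<theta>) = 1 - \<theta> ^ n"
    using \<theta> by (simp add: sum_gp_strict)
  then have w_sum: "(\<Sum>k\<le>n. w k) = 1"
    using sum_le_n[of "\<lambda>w J k. w"] by (simp add: mult.commute flip: sum_distrib_left)
  have G_meas: "G k \<in> borel_measurable M" for k
    unfolding G_def using J V_meas by (intro borel_measurable_Max) auto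
  have G_nonneg: "0 \<le> G k \<omega>" for k \<omega>
  proof -
    obtain j where "j \<in> J k" using J(2) by blast
    then have "\<bar>V k j \<omega>\<bar> \<le> G k \<omega>"
      unfolding G_def using J(1) by (intro Max_ge) auto
    then show ?thesis by linarith
  qed
  \<comment> \<open>Projection from level \<open>Suc k\<close> lands in \<open>N k\<close>, which is
    \<open>J k\<close> because \<open>k < n\<close>; the increments telescope down to level
    0.\<close>
  have chain: "\<bar>X j \<omega>\<bar> \<le> (\<Sum>i\<le>k. G i \<omega>)" if "j \<in> J k" "k \<le> n" for j k \<omega>
    using that
  proof (induction k arbitrary: j)
    case 0
    then have "\<bar>V 0 j \<omega>\<bar> \<le> G 0 \<omega>"
      unfolding G_def using J(1) by (intro Max_ge) auto
    then show ?case by (simp add: V_def)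
  next
    case (Suc k)
    then have "j \<in> S" using J(3) by blast
    then have "\<pi> k j \<in> J k"
      using \<pi>(1)[of j k] Suc.prems by (simp add: J_def)
    then have "\<bar>X (\<pi> k j) \<omega>\<bar> \<le> (\<Sum>i\<le>k. G i \<omega>)"
      using Suc by simp
    moreover have "\<bar>V (Suc k) j \<omega>\<bar> \<le> G (Suc k) \<omega>"
      unfolding G_def using J(1) Suc.prems by (intro Max_ge) auto
    ultimately show ?case by (simp add: V_def)
  qed
  have level: "(\<integral>\<^sup>+\<omega>. ennreal (exp (u / (m * w k) * G k \<omega>)) \<partial>M) \<le> ennreal (exp (C k))" if "k \<le> n" for k
  proof -
    \<comment> \<open>Equality for \<open>k < n\<close>; at the last level the ratio is 1.\<close>
    have "\<theta> ^ k / w k \<le> 1 / (1 - \<theta>)"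
      using \<theta> that by (auto simp: w_def field_simps)
    then have "(\<theta> ^ k / w k)\<^sup>2 \<le> (1 / (1 - \<theta>))\<^sup>2"
      using \<theta> w_pos[of k] by (intro power_mono) auto
    then have "u\<^sup>2 / 2 * (\<theta> ^ k / w k)\<^sup>2 \<le> u\<^sup>2 / 2 * (1 / (1 - \<theta>))\<^sup>2"
      by (intro mult_left_mono) auto
    then have exponent: "(u / (m * w k))\<^sup>2 * (\<theta> ^ k * m)\<^sup>2 / 2 \<le> u\<^sup>2 / (2 * (1 - \<theta>)\<^sup>2)"
      using m by (simp add: power_divide power_mult_distrib)
    have card: "card (J k) > 0"
      using J by (simp add: card_gt_0_iff)
    have "(\<integral>\<^sup>+\<omega>. ennreal (exp (u / (m * w k) * G k \<omega>)) \<partial>M)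
        \<le> ennreal (2 * real (card (J k)) * exp ((u / (m * w k))\<^sup>2 * (\<theta> ^ k * m)\<^sup>2 / 2))"
      unfolding G_def using J V_meas V_gauss V_sd u m w_pos[of k]
      by (intro nn_integral_exp_Max_gaussian_le M) auto
    also have "\<dots> \<le> ennreal (2 * real (card (J k)) * exp (u\<^sup>2 / (2 * (1 - \<theta>)\<^sup>2)))"
      using exponent by (intro ennreal_leI mult_left_mono) auto
    also have "\<dots> = ennreal (exp (C k))"
      using card by (simp add: C_def exp_add)
    finally show ?thesis .
  qed
  have "(\<integral>\<^sup>+\<omega>. ennreal (exp (u / m * (MAX t\<in>F. \<bar>X t \<omega>\<bar>))) \<partial>M)
     \<le> (\<integral>\<^sup>+\<omega>. ennreal (exp (\<Sum>k\<le>n. w k * (u / (m * w k) * G k \<omega>))) \<partial>M)"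
  proof (intro nn_integral_mono ennreal_leI)
    fix \<omega>
    have "(MAX t\<in>F. \<bar>X t \<omega>\<bar>) \<le> (\<Sum>k\<le>n. G k \<omega>)"
      using F chain[where k = n] by (auto simp: J_def)
    then have "u / m * (MAX t\<in>F. \<bar>X t \<omega>\<bar>) \<le> u / m * (\<Sum>k\<le>n. G k \<omega>)"
      using u m by (intro mult_left_mono) auto
    also have "\<dots> = (\<Sum>k\<le>n. w k * (u / (m * w k) * G k \<omega>))"
      unfolding sum_distrib_left using w_pos by (intro sum.cong) (auto simp: less_imp_neq[symmetric])
    finally show "exp (u / m * (MAX t\<in>F. \<bar>X t \<omega>\<bar>)) \<le> exp (\<Sum>k\<le>n. w k * (u / (m * w k) * G k \<omega>))"
      by simp
  qed
  also have "\<dots> \<le> ennreal (exp (\<Sum>k\<le>n. w k * C k))"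
    using w_pos w_sum level G_meas
    by (intro nn_integral_exp_weighted_sum_le M) (auto intro: less_imp_le)
  also have "(\<Sum>k\<le>n. w k * C k) = (\<Sum>k\<le>n. w k * ln (2 * real (card (J k)))) + u\<^sup>2 / (2 * (1 - \<theta>)\<^sup>2)"
    unfolding C_def distrib_left sum.distrib sum_distrib_right[symmetric] w_sum by simp
  finally show ?thesis
    using sum_le_n[of "\<lambda>w J k. w * ln (2 * real (card J))"] by (simp add: add_ac)
qed

subsection \<open>Nets and entropy of the blocks\<close>

text \<open>The interval is cut into cells of length \<open>2 * u\<close> whose midpoints are the
  centres; the minimum with \<open>hi\<close> keeps the last centre inside.\<close>

lemma interval_net:
  fixes lo hi u :: real
  assumes "lo \<le> hi" "u > 0"
  shows "\<exists>P. finite P \<and> P \<subseteq> {lo..hi} \<and> real (card P) \<le> (hi - lo) / (2 * u) + 1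
    \<and> (\<forall>t\<in>{lo..hi}. \<exists>p\<in>P. \<bar>t - p\<bar> \<le> u)"
proof -
  \<comment> \<open>One more than the floor, so that \<open>hi\<close> falls into a half-open cell
    even when the length is a multiple of \<open>2 * u\<close>.\<close>
  define n where "n = Suc (nat \<lfloor>(hi - lo) / (2 * u)\<rfloor>)"
  define f where "f i = min hi (lo + (2 * real i + 1) * u)" for i :: nat
  have "real (card (f ` {..<n})) \<le> real n"
    using card_image_le[of "{..<n}" f] by simp
  also have "\<dots> \<le> (hi - lo) / (2 * u) + 1"
    using assms by (simp add: n_def of_nat_nat)
  finally have card: "real (card (f ` {..<n})) \<le> (hi - lo) / (2 * u) + 1" .
  have "\<exists>p\<in>f ` {..<n}. \<bar>t - p\<bar> \<le> u" if t: "t \<in> {lo..hi}" for t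
  proof -
    define i where "i = nat \<lfloor>(t - lo) / (2 * u)\<rfloor>"
    have "0 \<le> (t - lo) / (2 * u)" "(t - lo) / (2 * u) \<le> (hi - lo) / (2 * u)"
      using t assms by (auto intro!: divide_right_mono)
    then have "i < n" and i: "real i \<le> (t - lo) / (2 * u)" "(t - lo) / (2 * u) < real i + 1"
      by (auto simp: i_def n_def less_Suc_eq_le nat_mono floor_mono)
    from i have "lo + 2 * real i * u \<le> t" "t \<le> lo + 2 * real i * u + 2 * u"
      using assms by (auto simp: field_simps)
    then have "\<bar>t - f i\<bar> \<le> u"
      using t by (auto simp: f_def algebra_simps min_def)
    with \<open>i < n\<close> show ?thesis by blast
  qed
  moreover have "f ` {..<n} \<subseteq> {lo..hi}"
    using assms by (auto simp: f_def)
  ultimately show ?thesis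
    using card by (intro exI[of _ "f ` {..<n}"]) auto
qed

text \<open>Clamping the centres to the interval is what keeps the nets of the blocks inside the index
  set, at no cost in cardinality.\<close>

lemma interval_neighbourhood_net:
  fixes lo hi u :: real
  assumes "lo \<le> hi" "u > 0"
  shows "\<exists>P. finite P \<and> P \<subseteq> {lo..hi} \<and> real (card P) \<le> (hi - lo) / (2 * u) + 2
    \<and> (\<forall>t\<in>{lo - u..hi + u}. \<exists>p\<in>P. \<bar>t - p\<bar> \<le> u)"
proof -
  have "(hi + u - (lo - u)) / (2 * u) + 1 = (hi - lo) / (2 * u) + 2"
    using assms by (simp add: field_simps)
  with interval_net[of "lo - u" "hi + u" u] assms obtain P where P: "finite P"
      "real (card P) \<le> (hi - lo) / (2 * u) + 2"
      "\<And>t. t \<in> {lo - u..hi + u} \<Longrightarrow> \<exists>p\<in>P. \<bar>t - p\<bar> \<le> u"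
    by auto
  define f where "f p = max lo (min hi p)" for p
  have "real (card (f ` P)) \<le> (hi - lo) / (2 * u) + 2"
    using card_image_le[OF P(1), of f] P(2) by linarith
  moreover have "\<exists>p\<in>f ` P. \<bar>t - p\<bar> \<le> u" if "t \<in> {lo - u..hi + u}" for t
  proof -
    from P(3)[OF that] obtain p where "p \<in> P" "\<bar>t - p\<bar> \<le> u" by blast
    moreover from this have "\<bar>t - f p\<bar> \<le> u"
      using that assms by (auto simp: f_def max_def min_def)
    ultimately show ?thesis by blast
  qed
  moreover have "f ` P \<subseteq> {lo..hi}"
    using assms by (auto simp: f_def)
  ultimately show ?thesis
    using P(1) by (intro exI[of _ "f ` P"]) auto
qed

text \<open>The net is fibred: a net \<open>P\<close> for the first coordinate and, over each
  \<open>x\<close> in \<open>P\<close>, a net of the fibre at \<open>x\<close>. A point whose first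
  coordinate is within \<open>u\<close> of \<open>x\<close> has its second coordinate in the fibre
  at \<open>x\<close> enlarged by \<open>u\<close>, so the fibre nets must cover that neighbourhood
  while staying in the fibre.\<close>

lemma Tblock_net:
  assumes "\<Delta> > 0" "0 \<le> b l" "b l < b (Suc l)" "\<Delta> \<le> 2 * (b (Suc l) - b l)" "u > 0"
  shows "\<exists>N. finite N \<and> N \<noteq> {} \<and> N \<subseteq> Tblock \<Delta> b l
    \<and> real (card N) \<le> 4 * (b (Suc l) - b l) / \<Delta> * (1 + \<Delta> / (4 * u))\<^sup>2
    \<and> (\<forall>t\<in>Tblock \<Delta> b l. \<exists>s\<in>N. dmax t s \<le> u)"
proof -
  define L where "L = b (Suc l) - b l"
  obtain P where P: "finite P" "P \<subseteq> {b l..b (Suc l)}" "real (card P) \<le> L / (2 * u) + 1"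
      "\<And>t. t \<in> {b l..b (Suc l)} \<Longrightarrow> \<exists>p\<in>P. \<bar>t - p\<bar> \<le> u"
    using interval_net[of "b l" "b (Suc l)" u] assms by (auto simp: L_def)
  have "\<forall>x\<in>P. \<exists>Q. finite Q \<and> Q \<subseteq> {max 0 (x - \<Delta>)..x} \<and> real (card Q) \<le> \<Delta> / (2 * u) + 2
    \<and> (\<forall>t\<in>{max 0 (x - \<Delta>) - u..x + u}. \<exists>q\<in>Q. \<bar>t - q\<bar> \<le> u)"
  proof
    fix x assume "x \<in> P"
    then have "0 \<le> x" using P(2) assms by auto
    then have "(x - max 0 (x - \<Delta>)) / (2 * u) \<le> \<Delta> / (2 * u)"
      using assms by (intro divide_right_mono) auto
    moreover obtain Q where "finite Q" "Q \<subseteq> {max 0 (x - \<Delta>)..x}"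
        "real (card Q) \<le> (x - max 0 (x - \<Delta>)) / (2 * u) + 2"
        "\<forall>t\<in>{max 0 (x - \<Delta>) - u..x + u}. \<exists>q\<in>Q. \<bar>t - q\<bar> \<le> u"
      using interval_neighbourhood_net[of "max 0 (x - \<Delta>)" x u] \<open>0 \<le> x\<close> assms by auto
    ultimately show "\<exists>Q. finite Q \<and> Q \<subseteq> {max 0 (x - \<Delta>)..x} \<and> real (card Q) \<le> \<Delta> / (2 * u) + 2
      \<and> (\<forall>t\<in>{max 0 (x - \<Delta>) - u..x + u}. \<exists>q\<in>Q. \<bar>t - q\<bar> \<le> u)"
      by (intro exI[of _ Q]) linarith
  qed
  from bchoice[OF this] obtain Q where "\<forall>x\<in>P. finite (Q x) \<and> Q x \<subseteq> {max 0 (x - \<Delta>)..x}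
      \<and> real (card (Q x)) \<le> \<Delta> / (2 * u) + 2
      \<and> (\<forall>t\<in>{max 0 (x - \<Delta>) - u..x + u}. \<exists>q\<in>Q x. \<bar>t - q\<bar> \<le> u)" ..
  then have Q: "\<And>x. x \<in> P \<Longrightarrow> finite (Q x)" "\<And>x. x \<in> P \<Longrightarrow> Q x \<subseteq> {max 0 (x - \<Delta>)..x}"
      "\<And>x. x \<in> P \<Longrightarrow> real (card (Q x)) \<le> \<Delta> / (2 * u) + 2"
      "\<And>x t. x \<in> P \<Longrightarrow> t \<in> {max 0 (x - \<Delta>) - u..x + u} \<Longrightarrow> \<exists>q\<in>Q x. \<bar>t - q\<bar> \<le> u"
    by blast+
  define N where "N = Sigma P Q"
  have cover: "\<exists>s\<in>N. dmax t s \<le> u" if t: "t \<in> Tblock \<Delta> b l" for t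
  proof -
    obtain x where x: "x \<in> P" "\<bar>fst t - x\<bar> \<le> u"
      using P(4)[of "fst t"] t by (auto simp: Tblock_def)
    then have "snd t \<in> {max 0 (x - \<Delta>) - u..x + u}"
      using t \<open>u > 0\<close> by (auto simp: Tblock_def)
    then obtain q where "q \<in> Q x" "\<bar>snd t - q\<bar> \<le> u"
      using Q(4) x by blast
    with x show ?thesis
      by (intro bexI[of _ "(x, q)"]) (auto simp: N_def dmax_def)
  qed
  have "(b l, b l) \<in> Tblock \<Delta> b l"
    using assms by (simp add: Tblock_def)
  from cover[OF this] have "N \<noteq> {}" by blast
  have fin: "finite N"
    using P Q by (auto simp: N_def)
  have sub: "N \<subseteq> Tblock \<Delta> b l"
    using P(2) Q(2) assms by (fastforce simp: N_def Tblock_def)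
  have "real (card N) = (\<Sum>x\<in>P. real (card (Q x)))"
    using P Q by (simp add: N_def card_SigmaI)
  also have "\<dots> \<le> real (card P) * (\<Delta> / (2 * u) + 2)"
    using Q(3) sum_bounded_above[of P "\<lambda>x. real (card (Q x))"] by simp
  also have "\<dots> \<le> (L / (2 * u) + 1) * (\<Delta> / (2 * u) + 2)"
    using P(3) assms by (intro mult_right_mono) auto
  \<comment> \<open>By \<open>\<Delta> \<le> 2 * L\<close> the summand 1 is at most
    \<open>2 * L / \<Delta>\<close>, which makes both factors multiples of
    \<open>1 + \<Delta> / (4 * u)\<close>.\<close>
  also have "\<dots> \<le> (2 * L / \<Delta> * (1 + \<Delta> / (4 * u))) * (\<Delta> / (2 * u) + 2)"
  proof (rule mult_right_mono)
    have "1 \<le> 2 * L / \<Delta>" using assms by (simp add: L_def)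
    moreover have "2 * L / \<Delta> * (1 + \<Delta> / (4 * u)) = 2 * L / \<Delta> + L / (2 * u)"
      using assms by (simp add: field_simps)
    ultimately show "L / (2 * u) + 1 \<le> 2 * L / \<Delta> * (1 + \<Delta> / (4 * u))" by linarith
  qed (use assms in auto)
  also have "\<dots> = 4 * L / \<Delta> * (1 + \<Delta> / (4 * u))\<^sup>2"
    using assms by (simp add: field_simps power2_eq_square)
  finally show ?thesis
    using \<open>N \<noteq> {}\<close> fin sub cover by (auto simp: L_def)
qed

text \<open>The factor 2 before the logarithm is the square in the net cardinality, that is, the
  dimension of the index set. Raising \<open>x powr \<epsilon>\<close> to the power
  \<open>2 * \<gamma> / \<epsilon>\<close> cancels \<epsilon> from the exponent of \<open>x\<close>,
  leaving it only in the constants.\<close>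

lemma weighted_entropy_sum_le:
  fixes \<theta> \<beta> \<epsilon> \<gamma> x :: real
  assumes "0 < \<theta>" "\<theta> < 1" "0 < \<beta>" "\<beta> \<le> 1" "0 < \<epsilon>" "\<epsilon> < \<beta>" "0 < \<gamma>" "\<gamma> \<le> 1" "0 < x"
  shows "(\<Sum>k<n. (1 - \<theta>) * \<theta> ^ k * (2 * ln (1 + x * (\<theta> ^ k) powr (- 1 / \<beta>))))
    \<le> (2 / \<epsilon> - 1) * ln 2 + x powr (2 * \<gamma>) / (\<gamma> * (1 - \<epsilon> / \<beta>) powr (2 * \<gamma> / \<epsilon>))"
proof -
  define w where "w k = (1 - \<theta>) * \<theta> ^ k" for k :: nat
  define y where "y k = x * (\<theta> ^ k) powr (- 1 / \<beta>)" for k :: nat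
  define z where "z = x powr \<epsilon> / (1 - \<epsilon> / \<beta>)"
  have \<epsilon>\<beta>: "0 < 1 - \<epsilon> / \<beta>" "0 < \<epsilon> / \<beta>" "\<epsilon> / \<beta> < 1" using assms by auto
  have z: "z > 0" using assms \<epsilon>\<beta> by (simp add: z_def)
  have y: "y k > 0" for k using assms by (simp add: y_def)
  have w: "w k \<ge> 0" for k using assms by (simp add: w_def)
  have "sum w {..<n} = 1 - \<theta> ^ n"
    using assms by (simp add: w_def sum_gp_strict flip: sum_distrib_left)
  then have w_sum: "sum w {..<n} \<le> 1" using assms by simp
  have "(\<Sum>k<n. w k * (y k) powr \<epsilon>) = x powr \<epsilon> * (\<Sum>k<n. (1 - \<theta>) * \<theta> ^ k * (\<theta> ^ k) powr (- (\<epsilon> / \<beta>)))"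
    using assms by (simp add: w_def y_def powr_mult powr_powr sum_distrib_left mult_ac)
  also have "\<dots> \<le> x powr \<epsilon> * (1 / (1 - \<epsilon> / \<beta>))"
    using assms \<epsilon>\<beta> by (intro mult_left_mono geometric_weighted_powr_sum_le) auto
  finally have yz: "(\<Sum>k<n. w k * (y k) powr \<epsilon>) \<le> z" by (simp add: z_def)
  \<comment> \<open>The weights of the constant 1 and the missing mass together give exactly
    1.\<close>
  have "exp (\<Sum>k<n. w k * ln (1 + y k powr \<epsilon>)) \<le> (\<Sum>k<n. w k * exp (ln (1 + y k powr \<epsilon>))) + (1 - sum w {..<n})"
    using w w_sum by (intro exp_weighted_sum_le) auto
  also have "\<dots> = 1 + (\<Sum>k<n. w k * (y k) powr \<epsilon>)"
    by (simp add: add_pos_nonneg distrib_left sum.distrib)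
  finally have "exp (\<Sum>k<n. w k * ln (1 + y k powr \<epsilon>)) \<le> 1 + z"
    using yz by linarith
  then have sum_le: "(\<Sum>k<n. w k * ln (1 + y k powr \<epsilon>)) \<le> ln (1 + z)"
    using z by (subst ln_ge_iff) auto
  have ln_le: "\<epsilon> * ln (1 + y k) \<le> ln (1 + y k powr \<epsilon>)" for k
  proof -
    have "\<epsilon> * ln (1 + y k) = ln ((1 + y k) powr \<epsilon>)"
      using y[of k] by (simp add: ln_powr)
    also have "\<dots> \<le> ln (1 + y k powr \<epsilon>)"
      using powr_one_plus_le[of \<epsilon> "y k"] y[of k] assms by (intro ln_mono) auto
    finally show ?thesis .
  qed
  have "(\<Sum>k<n. w k * (2 * ln (1 + y k))) = 2 / \<epsilon> * (\<Sum>k<n. w k * (\<epsilon> * ln (1 + y k)))"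
    using assms by (simp add: sum_distrib_left mult_ac)
  also have "\<dots> \<le> 2 / \<epsilon> * (\<Sum>k<n. w k * ln (1 + y k powr \<epsilon>))"
    using assms w ln_le by (intro mult_left_mono sum_mono) auto
  also have "\<dots> \<le> 2 / \<epsilon> * ln (1 + z)"
    using assms sum_le by (intro mult_left_mono) auto
  also have "\<dots> \<le> (2 / \<epsilon> - 1) * ln 2 + z powr (2 * \<gamma> / \<epsilon>) / \<gamma>"
    using assms z by (intro ln_one_plus_le_powr) auto
  also have "z powr (2 * \<gamma> / \<epsilon>) = x powr (2 * \<gamma>) / (1 - \<epsilon> / \<beta>) powr (2 * \<gamma> / \<epsilon>)"
    using assms \<epsilon>\<beta> by (simp add: z_def powr_divide powr_powr)
  finally show ?thesis
    by (simp add: w_def y_def mult.commute)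
qed

section \<open>Exponential moment of a single block\<close>

lemma Tblock_subset_TDelta: "Tblock \<Delta> b l \<subseteq> TDelta \<Delta>"
  by (auto simp: Tblock_def TDelta_def)

text \<open>The modulus of continuity turns metric nets into nets in standard deviation. The
  chaining bound holds at every depth \<open>n\<close> for fixed \<open>F\<close>; letting
  \<open>n\<close> tend to infinity removes the dependence on \<open>F\<close>.\<close>

lemma nn_integral_exp_Max_Tblock_le:
  fixes X :: "real \<times> real \<Rightarrow> 'w \<Rightarrow> real"
  assumes gauss: "centered_gaussian_process M (TDelta \<Delta>) X"
    and \<Delta>: "\<Delta> > 0" and b: "0 \<le> b l" "b l < b (Suc l)" "\<Delta> \<le> 2 * (b (Suc l) - b l)"
    and m: "m > 0" and sd: "\<And>t. t \<in> Tblock \<Delta> b l \<Longrightarrow> sqrt (\<integral>\<omega>. (X t \<omega>)\<^sup>2 \<partial>M) \<le> m"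
    and c: "c > 0"
    and modulus: "\<And>h t s. h > 0 \<Longrightarrow> t \<in> Tblock \<Delta> b l \<Longrightarrow> s \<in> Tblock \<Delta> b l \<Longrightarrow> dmax t s \<le> h \<Longrightarrow>
               sqrt (\<integral>\<omega>. (X t \<omega> - X s \<omega>)\<^sup>2 \<partial>M) \<le> c * h powr \<beta>"
    and par: "0 < \<theta>" "\<theta> < 1" "0 < \<beta>" "\<beta> \<le> 1" "0 < \<epsilon>" "\<epsilon> < \<beta>" "0 < \<gamma>" "\<gamma> \<le> 1"
    and F: "finite F" "F \<noteq> {}" "F \<subseteq> Tblock \<Delta> b l" and u: "u \<ge> 0"
  shows "(\<integral>\<^sup>+\<omega>. ennreal (exp (u / m * (MAX t\<in>F. \<bar>X t \<omega>\<bar>))) \<partial>M)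
    \<le> ennreal (exp (u\<^sup>2 / (2 * (1 - \<theta>)\<^sup>2) + ln (2 powr (2 / \<epsilon> + 2) / \<Delta> * (b (Suc l) - b l))
         + \<Delta> powr (2 * \<gamma>) / (\<gamma> * (1 - \<epsilon> / \<beta>) powr (2 * \<gamma> / \<epsilon>) * \<theta> powr (2 * \<gamma> / \<beta>) * 4 powr (2 * \<gamma>))
           * (c / m) powr (2 * \<gamma> / \<beta>)))"
    (is "?I \<le> ennreal (exp ?C)")
proof -
  define L where "L = b (Suc l) - b l"
  have L: "L > 0" "\<Delta> \<le> 2 * L" using b by (auto simp: L_def)
  \<comment> \<open>The radius at which the modulus \<open>c * h powr \<beta>\<close> equals the
    level \<open>\<theta> ^ Suc k * m\<close> required by the chaining.\<close>
  define r where "r k = (\<theta> ^ Suc k * m / c) powr (1 / \<beta>)" for k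
  have r: "r k > 0" and r_powr: "c * r k powr \<beta> = \<theta> ^ Suc k * m" for k
    using par m c by (auto simp: r_def powr_powr)
  \<comment> \<open>This is \<open>\<Delta> / (4 * r 0)\<close>; at level \<open>k\<close> the ratio
    grows by the factor \<open>(\<theta> ^ k) powr (- 1 / \<beta>)\<close>.\<close>
  define x where "x = \<Delta> / 4 * (c / (\<theta> * m)) powr (1 / \<beta>)"
  have x: "x > 0" using \<Delta> m c par by (simp add: x_def)
  have "\<forall>k. \<exists>N. finite N \<and> N \<noteq> {} \<and> N \<subseteq> Tblock \<Delta> b l
    \<and> real (card N) \<le> 4 * L / \<Delta> * (1 + \<Delta> / (4 * r k))\<^sup>2 \<and> (\<forall>t\<in>Tblock \<Delta> b l. \<exists>s\<in>N. dmax t s \<le> r k)"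
    unfolding L_def using Tblock_net[OF \<Delta> b r] by blast
  from choice[OF this] obtain N where N': "\<forall>k. finite (N k) \<and> N k \<noteq> {} \<and> N k \<subseteq> Tblock \<Delta> b l
    \<and> real (card (N k)) \<le> 4 * L / \<Delta> * (1 + \<Delta> / (4 * r k))\<^sup>2
    \<and> (\<forall>t\<in>Tblock \<Delta> b l. \<exists>s\<in>N k. dmax t s \<le> r k)" ..
  then have N: "finite (N k)" "N k \<noteq> {}" "N k \<subseteq> Tblock \<Delta> b l"
      "real (card (N k)) \<le> 4 * L / \<Delta> * (1 + \<Delta> / (4 * r k))\<^sup>2"
      "\<forall>t\<in>Tblock \<Delta> b l. \<exists>s\<in>N k. dmax t s \<le> r k" for k
    by simp_all
  have net: "\<exists>s\<in>N k. sqrt (\<integral>\<omega>. (X t \<omega> - X s \<omega>)\<^sup>2 \<partial>M) \<le> \<theta> ^ Suc k * m"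
    if t: "t \<in> Tblock \<Delta> b l" for k t
  proof -
    obtain s where s: "s \<in> N k" "dmax t s \<le> r k" using bspec[OF N(5) t] ..
    have "s \<in> Tblock \<Delta> b l" using subsetD[OF N(3) s(1)] .
    with modulus[OF r t _ s(2)] have "sqrt (\<integral>\<omega>. (X t \<omega> - X s \<omega>)\<^sup>2 \<partial>M) \<le> \<theta> ^ Suc k * m"
      unfolding r_powr .
    then show ?thesis using s(1) ..
  qed
  have ratio: "\<Delta> / (4 * r k) = x * (\<theta> ^ k) powr (- 1 / \<beta>)" for k
  proof -
    have "(c / (\<theta> * m)) powr (1 / \<beta>) = (\<theta> ^ k) powr (1 / \<beta>) * (c / (\<theta> ^ Suc k * m)) powr (1 / \<beta>)"
      using par m c by (subst powr_mult[symmetric]) auto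
    moreover have "(c / (\<theta> ^ Suc k * m)) powr (1 / \<beta>) = 1 / r k"
      using par m c by (simp add: r_def powr_divide)
    moreover have "(\<theta> ^ k) powr (- 1 / \<beta>) = 1 / (\<theta> ^ k) powr (1 / \<beta>)"
      using powr_minus_divide[of "\<theta> ^ k" "1 / \<beta>"] by simp
    moreover have "(\<theta> ^ k) powr (1 / \<beta>) > 0"
      using par by simp
    ultimately show ?thesis by (simp add: x_def)
  qed
  \<comment> \<open>The 8 combines the 4 of the net cardinality with the 2 of the absolute
    value.\<close>
  have ln_card: "ln (2 * real (card (N k))) \<le> ln (8 * L / \<Delta>) + 2 * ln (1 + x * (\<theta> ^ k) powr (- 1 / \<beta>))" for k
  proof -
    have pos: "1 + x * (\<theta> ^ k) powr (- 1 / \<beta>) > 0"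
      using x by (simp add: add_pos_nonneg)
    have "card (N k) > 0" using N(1,2) by (simp add: card_gt_0_iff)
    then have "ln (2 * real (card (N k))) \<le> ln (8 * L / \<Delta> * (1 + x * (\<theta> ^ k) powr (- 1 / \<beta>))\<^sup>2)"
      using N(4)[of k] unfolding ratio by (intro ln_mono) auto
    also have "\<dots> = ln (8 * L / \<Delta>) + 2 * ln (1 + x * (\<theta> ^ k) powr (- 1 / \<beta>))"
      using L \<Delta> pos by (subst ln_mult) (auto simp: ln_realpow)
    finally show ?thesis .
  qed
  have entropy: "(\<Sum>k<n. (1 - \<theta>) * \<theta> ^ k * ln (2 * real (card (N k))))
      \<le> ln (8 * L / \<Delta>) + ((2 / \<epsilon> - 1) * ln 2 + x powr (2 * \<gamma>) / (\<gamma> * (1 - \<epsilon> / \<beta>) powr (2 * \<gamma> / \<epsilon>)))" for n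
  proof -
    have "(\<Sum>k<n. (1 - \<theta>) * \<theta> ^ k * ln (2 * real (card (N k))))
        \<le> (\<Sum>k<n. (1 - \<theta>) * \<theta> ^ k * (ln (8 * L / \<Delta>) + 2 * ln (1 + x * (\<theta> ^ k) powr (- 1 / \<beta>))))"
      using par by (intro sum_mono mult_left_mono ln_card) auto
    also have "\<dots> = (\<Sum>k<n. (1 - \<theta>) * \<theta> ^ k) * ln (8 * L / \<Delta>)
        + (\<Sum>k<n. (1 - \<theta>) * \<theta> ^ k * (2 * ln (1 + x * (\<theta> ^ k) powr (- 1 / \<beta>))))"
      by (simp only: distrib_left sum.distrib sum_distrib_right)
    also have "(\<Sum>k<n. (1 - \<theta>) * \<theta> ^ k) = 1 - \<theta> ^ n"
      using par by (simp add: sum_gp_strict flip: sum_distrib_left)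
    \<comment> \<open>The logarithm is nonnegative because
      \<open>\<Delta> \<le> 2 * L\<close>.\<close>
    also have "(1 - \<theta> ^ n) * ln (8 * L / \<Delta>) \<le> 1 * ln (8 * L / \<Delta>)"
      using par L \<Delta> by (intro mult_right_mono) auto
    also have "(\<Sum>k<n. (1 - \<theta>) * \<theta> ^ k * (2 * ln (1 + x * (\<theta> ^ k) powr (- 1 / \<beta>))))
        \<le> (2 / \<epsilon> - 1) * ln 2 + x powr (2 * \<gamma>) / (\<gamma> * (1 - \<epsilon> / \<beta>) powr (2 * \<gamma> / \<epsilon>))"
      by (intro weighted_entropy_sum_le par x)
    finally show ?thesis by simp
  qed
  have const: "u\<^sup>2 / (2 * (1 - \<theta>)\<^sup>2)
      + (ln (8 * L / \<Delta>) + ((2 / \<epsilon> - 1) * ln 2 + x powr (2 * \<gamma>) / (\<gamma> * (1 - \<epsilon> / \<beta>) powr (2 * \<gamma> / \<epsilon>)))) = ?C"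
  proof -
    \<comment> \<open>Writing 8 as the third power of 2 raises the exponent
      \<open>2 / \<epsilon> - 1\<close> to \<open>2 / \<epsilon> + 2\<close>.\<close>
    have "ln (8 * L / \<Delta>) + (2 / \<epsilon> - 1) * ln 2 = ln (2 powr (2 / \<epsilon> - 1) * (8 * L / \<Delta>))"
      using L \<Delta> by (subst ln_mult) (auto simp: ln_powr)
    also have "2 powr (2 / \<epsilon> - 1) * (8 * L / \<Delta>) = 2 powr (2 / \<epsilon> + 2) / \<Delta> * L"
      by (simp add: powr_add powr_diff)
    finally have 1: "ln (8 * L / \<Delta>) + (2 / \<epsilon> - 1) * ln 2 = ln (2 powr (2 / \<epsilon> + 2) / \<Delta> * L)" .
    have "x powr (2 * \<gamma>) = \<Delta> powr (2 * \<gamma>) / 4 powr (2 * \<gamma>) * ((c / m) powr (2 * \<gamma> / \<beta>) / \<theta> powr (2 * \<gamma> / \<beta>))"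
      using \<Delta> c m par by (simp add: x_def powr_mult powr_divide powr_powr)
    then have "x powr (2 * \<gamma>) / (\<gamma> * (1 - \<epsilon> / \<beta>) powr (2 * \<gamma> / \<epsilon>))
      = \<Delta> powr (2 * \<gamma>) / (\<gamma> * (1 - \<epsilon> / \<beta>) powr (2 * \<gamma> / \<epsilon>) * \<theta> powr (2 * \<gamma> / \<beta>) * 4 powr (2 * \<gamma>))
           * (c / m) powr (2 * \<gamma> / \<beta>)"
      by (simp add: mult_ac)
    with 1 show ?thesis by (simp add: L_def)
  qed
  have bound: "?I \<le> ennreal (exp (?C + \<theta> ^ n * ln (2 * real (card F))))" for n
  proof -
    have "?I \<le> ennreal (exp (u\<^sup>2 / (2 * (1 - \<theta>)\<^sup>2)
         + (\<Sum>k<n. (1 - \<theta>) * \<theta> ^ k * ln (2 * real (card (N k)))) + \<theta> ^ n * ln (2 * real (card F))))"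
      by (rule gaussian_chaining_bound[OF gauss Tblock_subset_TDelta m sd par(1,2) N(1-3) net F u])
    also have "\<dots> \<le> ennreal (exp (?C + \<theta> ^ n * ln (2 * real (card F))))"
      unfolding const[symmetric] using entropy[of n] by (intro ennreal_leI) simp
    finally show ?thesis .
  qed
  have "(\<lambda>n. ?C + \<theta> ^ n * ln (2 * real (card F))) \<longlonglongrightarrow> ?C + 0 * ln (2 * real (card F))"
    using par by (intro tendsto_intros LIMSEQ_realpow_zero) auto
  then have "(\<lambda>n. ennreal (exp (?C + \<theta> ^ n * ln (2 * real (card F))))) \<longlonglongrightarrow> ennreal (exp ?C)"
    by (intro tendsto_ennrealI tendsto_exp) simp
  then show ?thesis
    by (rule LIMSEQ_le_const) (use bound in blast)
qed

section \<open>Covering by blocks and passage from finite to uncountable suprema\<close>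

text \<open>The block index is the predecessor of the first \<open>n\<close> with
  \<open>fst t < b n\<close>; it exists since \<open>b 0 = 0\<close>.\<close>

lemma TDelta_subset_Tblocks:
  assumes "b 0 = 0" "mono b" "filterlim b at_top sequentially" "t \<in> TDelta \<Delta>"
  shows "\<exists>l. t \<in> Tblock \<Delta> b l"
proof -
  have ex: "\<exists>n. fst t < b n"
    using assms(3) by (auto simp: filterlim_at_top_dense eventually_sequentially)
  define n where "n = (LEAST n. fst t < b n)"
  have n: "fst t < b n" "\<And>k. k < n \<Longrightarrow> \<not> fst t < b k"
    unfolding n_def using LeastI_ex[OF ex] not_less_Least by blast+
  have "0 \<le> fst t" using assms by (simp add: TDelta_def)
  with n(1) assms(1) obtain l where "n = Suc l" by (cases n) auto
  with n(1) n(2)[of l] assms(4) show ?thesis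
    by (intro exI[of _ l]) (auto simp: Tblock_def TDelta_def)
qed

text \<open>A separant of the process also serves the weighted process, since the weight is
  continuous and positive: the quotients converge along the approximating sequence.\<close>

lemma separable_SUP_le:
  fixes f :: "'i::metric_space \<Rightarrow> real"
  assumes "separable_process M T X" "continuous_on T f" "\<And>t. t \<in> T \<Longrightarrow> f t > 0"
  obtains S where "S \<subseteq> T" "countable S"
    "AE \<omega> in M. (SUP t\<in>T. ennreal (exp (lam * (\<bar>X t \<omega>\<bar> / f t))))
        \<le> (SUP t\<in>S. ennreal (exp (lam * (\<bar>X t \<omega>\<bar> / f t))))"
proof -
  obtain S N where S: "S \<subseteq> T" "countable S" and N: "N \<in> null_sets M"
    and lim: "\<And>\<omega> t. \<omega> \<in> space M - N \<Longrightarrow> t \<in> T \<Longrightarrow>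
      \<exists>s::nat \<Rightarrow> 'i. (\<forall>n. s n \<in> S) \<and> s \<longlonglongrightarrow> t \<and> (\<lambda>n. X (s n) \<omega>) \<longlonglongrightarrow> X t \<omega>"
    using assms(1) unfolding separable_process_def by blast
  have le: "(SUP t\<in>T. ennreal (exp (lam * (\<bar>X t \<omega>\<bar> / f t))))
        \<le> (SUP t\<in>S. ennreal (exp (lam * (\<bar>X t \<omega>\<bar> / f t))))" if \<omega>: "\<omega> \<in> space M - N" for \<omega>
  proof (rule SUP_least)
    fix t assume t: "t \<in> T"
    then obtain s where s: "\<And>n. s n \<in> S" "s \<longlonglongrightarrow> t" "(\<lambda>n. X (s n) \<omega>) \<longlonglongrightarrow> X t \<omega>"
      using lim[OF \<omega>] by blast
    have "(\<lambda>n. f (s n)) \<longlonglongrightarrow> f t"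
      using s S t by (intro continuous_on_tendsto_compose[OF assms(2)] always_eventually) auto
    then have "(\<lambda>n. ennreal (exp (lam * (\<bar>X (s n) \<omega>\<bar> / f (s n))))) \<longlonglongrightarrow> ennreal (exp (lam * (\<bar>X t \<omega>\<bar> / f t)))"
      using s(3) assms(3)[OF t]
      by (intro tendsto_ennrealI tendsto_exp tendsto_mult tendsto_divide tendsto_rabs tendsto_const) auto
    then show "ennreal (exp (lam * (\<bar>X t \<omega>\<bar> / f t))) \<le> (SUP t\<in>S. ennreal (exp (lam * (\<bar>X t \<omega>\<bar> / f t))))"
      by (rule LIMSEQ_le_const2) (auto intro!: SUP_upper s(1))
  qed
  show ?thesis
  proof (rule that[OF S])
    show "AE \<omega> in M. (SUP t\<in>T. ennreal (exp (lam * (\<bar>X t \<omega>\<bar> / f t))))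
        \<le> (SUP t\<in>S. ennreal (exp (lam * (\<bar>X t \<omega>\<bar> / f t))))"
      using N le by (intro AE_I'[OF N]) auto
  qed
qed

text \<open>Monotone convergence along the initial segments of an enumeration reduces the countable
  supremum to finite ones.\<close>

lemma nn_integral_countable_SUP_le:
  fixes f :: "'i \<Rightarrow> 'w \<Rightarrow> ennreal"
  assumes "countable S" "\<And>t. t \<in> S \<Longrightarrow> f t \<in> borel_measurable M"
    and bound: "\<And>F. finite F \<Longrightarrow> F \<subseteq> S \<Longrightarrow> (\<integral>\<^sup>+\<omega>. (SUP t\<in>F. f t \<omega>) \<partial>M) \<le> B"
  shows "(\<integral>\<^sup>+\<omega>. (SUP t\<in>S. f t \<omega>) \<partial>M) \<le> B"
proof (cases "S = {}")
  case True
  with bound[of "{}"] show ?thesis by simp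
next
  case False
  define F where "F n = from_nat_into S ` {..n}" for n
  have F: "F n \<subseteq> S" "finite (F n)" for n
    using from_nat_into[OF False] by (auto simp: F_def)
  have "(\<Union>n. F n) = S"
    using F(1) from_nat_into_surj[OF \<open>countable S\<close>] by (fastforce simp: F_def)
  moreover have "(SUP t\<in>(\<Union>n. F n). f t \<omega>) = (SUP n. SUP t\<in>F n. f t \<omega>)" for \<omega>
    by (rule SUP_UNION)
  ultimately have "(\<integral>\<^sup>+\<omega>. (SUP t\<in>S. f t \<omega>) \<partial>M) = (\<integral>\<^sup>+\<omega>. (SUP n. SUP t\<in>F n. f t \<omega>) \<partial>M)"
    by simp
  also have "\<dots> = (SUP n. \<integral>\<^sup>+\<omega>. (SUP t\<in>F n. f t \<omega>) \<partial>M)"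
  proof (rule nn_integral_monotone_convergence_SUP)
    show "incseq (\<lambda>n \<omega>. SUP t\<in>F n. f t \<omega>)"
      by (auto simp: incseq_def le_fun_def F_def intro!: SUP_subset_mono)
    show "(\<lambda>\<omega>. SUP t\<in>F n. f t \<omega>) \<in> borel_measurable M" for n
      using assms F by (intro borel_measurable_SUP) (auto intro: countable_finite)
  qed
  also have "\<dots> \<le> B"
    by (intro SUP_least bound F)
  finally show ?thesis .
qed

text \<open>The supremum is taken over the \<open>ennreal\<close> exponentials, so it is meaningful
  also on paths where the process is unbounded. Positivity of \<open>A\<close> gives the divisions
  by \<open>A\<close> their meaning. In Isabelle 0 to a negative power is 0, whereas the third
  series is read with the value infinity there; \<open>viii_3_finite\<close> expresses that no such
  term occurs.\<close>

theorem theorem4: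
  fixes \<Delta> :: real and b :: "nat \<Rightarrow> real" and a :: "real \<Rightarrow> real"
    and M :: "'w measure" and X :: "real \<times> real \<Rightarrow> 'w \<Rightarrow> real"
    and \<beta> \<gamma> :: real and c :: "nat \<Rightarrow> real"
    and \<theta> \<epsilon> lam :: real
  assumes Delta_pos: "\<Delta> > 0"
    and b0: "b 0 = 0"
    and b_mono: "mono b"
    and b_gap: "\<forall>l. b (Suc l) - b l \<ge> 1"
    and b_lim: "filterlim b at_top sequentially"
    and a_pos: "\<forall>t\<ge>0. a t > 0"
    and a_cont: "continuous_on {0..} a"
    and a_mono: "mono_on {0..} a"
    and Delta_le: "\<forall>l. \<Delta> \<le> 2 * (b (Suc l) - b l)"
    and gauss: "centered_gaussian_process M (TDelta \<Delta>) X"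
    and sep: "separable_process M (TDelta \<Delta>) X"
    and vi: "\<forall>l. bdd_above ((\<lambda>t. sqrt (\<integral>\<omega>. (X t \<omega>)\<^sup>2 \<partial>M)) ` Tblock \<Delta> b l)"
    and beta: "0 < \<beta>" "\<beta> \<le> 1"
    and c_pos: "\<forall>l. c l > 0"
    and vii: "\<forall>l h t s. h > 0 \<longrightarrow> t \<in> Tblock \<Delta> b l \<longrightarrow> s \<in> Tblock \<Delta> b l \<longrightarrow> dmax t s \<le> h \<longrightarrow>
               sqrt (\<integral>\<omega>. (X t \<omega> - X s \<omega>)\<^sup>2 \<partial>M) \<le> c l * h powr \<beta>"
    and viii_1: "summable (\<lambda>l. sd_sup M X (Tblock \<Delta> b l) / a (b l))"
    and A_pos: "(\<Sum>l. sd_sup M X (Tblock \<Delta> b l) / a (b l)) > 0"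
    and viii_2: "summable (\<lambda>l. sd_sup M X (Tblock \<Delta> b l) * ln (b (Suc l) - b l) / a (b l))"
    and gamma: "0 < \<gamma>" "\<gamma> \<le> 1"
    and viii_3_finite: "\<forall>l. sd_sup M X (Tblock \<Delta> b l) = 0 \<longrightarrow> 1 - 2 * \<gamma> / \<beta> \<ge> 0"
    and viii_3: "summable (\<lambda>l. rpow (sd_sup M X (Tblock \<Delta> b l)) (1 - 2 * \<gamma> / \<beta>)
                              * c l powr (2 * \<gamma> / \<beta>) / a (b l))"
    and theta: "0 < \<theta>" "\<theta> < 1"
    and eps: "0 < \<epsilon>" "\<epsilon> < \<beta>"
    and lambda: "lam > 0"
  shows "(\<integral>\<^sup>+ \<omega>. (SUP t\<in>TDelta \<Delta>. ennreal (exp (lam * (\<bar>X t \<omega>\<bar> / a (fst t))))) \<partial>M)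
    \<le> ennreal (
      (let m = (\<lambda>l. sd_sup M X (Tblock \<Delta> b l));
           A = (\<Sum>l. m l / a (b l))
       in exp (lam\<^sup>2 * A\<^sup>2 / (2 * (1 - \<theta>)\<^sup>2)) *
          (2 powr (2 / \<epsilon> + 2) / \<Delta>
           * exp (1 / A * (\<Sum>l. m l * ln (b (Suc l) - b l) / a (b l)))
           * exp (\<Delta> powr (2 * \<gamma>)
                  / (\<gamma> * A * (1 - \<epsilon> / \<beta>) powr (2 * \<gamma> / \<epsilon>) * \<theta> powr (2 * \<gamma> / \<beta>)
                     * 4 powr (2 * \<gamma>))
                  * (\<Sum>l. c l powr (2 * \<gamma> / \<beta>) * rpow (m l) (1 - 2 * \<gamma> / \<beta>) / a (b l))))))"
proof -
  define T where "T = Tblock \<Delta> b"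
  define m where "m l = sd_sup M X (T l)" for l
  define \<alpha> where "\<alpha> l = a (b l)" for l
  define A where "A = (\<Sum>l. m l / \<alpha> l)"
  define L where "L l = b (Suc l) - b l" for l
  define D where "D = \<Delta> powr (2 * \<gamma>) / (\<gamma> * (1 - \<epsilon> / \<beta>) powr (2 * \<gamma> / \<epsilon>) * \<theta> powr (2 * \<gamma> / \<beta>) * 4 powr (2 * \<gamma>))"
  \<comment> \<open>Every block is used with the same parameter \<open>u = lam * A\<close>, because
    \<open>w l * (lam * A / m l)\<close> is \<open>lam / \<alpha> l\<close>.\<close>
  define P where "P = (lam * A)\<^sup>2 / (2 * (1 - \<theta>)\<^sup>2)"
  define Q where "Q = 2 powr (2 / \<epsilon> + 2) / \<Delta>"
  define w where "w l = m l / \<alpha> l / A" for l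
  \<comment> \<open>Logarithm of the single-block bound, meaningful for
    \<open>m l > 0\<close>.\<close>
  define K where "K l = P + ln (Q * L l) + D * (c l / m l) powr (2 * \<gamma> / \<beta>)" for l
  define R where "R l = rpow (m l) (1 - 2 * \<gamma> / \<beta>) * c l powr (2 * \<gamma> / \<beta>) / \<alpha> l" for l
  \<comment> \<open>This agrees with \<open>w l * K l\<close> when \<open>m l > 0\<close>, but is
    split so that its sum over all \<open>l\<close> reads off from the three given series. When
    \<open>m l = 0\<close> only the nonnegative term with \<open>R l\<close> can remain.\<close>
  define E where "E l = w l * (P + ln Q) + (1 / A * (m l * ln (L l) / \<alpha> l) + D / A * R l)" for l

  have M: "prob_space M" and meas: "\<And>t. t \<in> TDelta \<Delta> \<Longrightarrow> X t \<in> borel_measurable M"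
    using gauss unfolding centered_gaussian_process_def by blast+
  have T_sub: "T l \<subseteq> TDelta \<Delta>" for l
    unfolding T_def by (rule Tblock_subset_TDelta)
  have b_nonneg: "b l \<ge> 0" for l
    using monoD[OF b_mono, of 0 l] b0 by simp
  have L: "L l \<ge> 1" "\<Delta> \<le> 2 * L l" "b l < b (Suc l)" for l
    using b_gap[rule_format, of l] Delta_le[rule_format, of l] by (auto simp: L_def)
  have \<alpha>: "\<alpha> l > 0" for l
    using a_pos b_nonneg by (simp add: \<alpha>_def)
  have A: "A > 0"
    using A_pos by (simp add: A_def m_def \<alpha>_def T_def)
  have D: "D > 0"
    using Delta_pos gamma eps beta theta by (simp add: D_def)
  have P: "P \<ge> 0" by (simp add: P_def)
  have Q: "Q > 0" using Delta_pos by (simp add: Q_def)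
  have sd: "sqrt (\<integral>\<omega>. (X t \<omega>)\<^sup>2 \<partial>M) \<le> m l" if "t \<in> T l" for t l
    unfolding m_def sd_sup_def using vi that by (intro cSUP_upper) (auto simp: T_def)
  have m_nonneg: "m l \<ge> 0" for l
  proof -
    have "(b l, b l) \<in> T l"
      using b_nonneg[of l] L(3)[of l] Delta_pos by (simp add: T_def Tblock_def)
    from sd[OF this] show ?thesis
      by (rule order_trans[rotated]) simp
  qed
  have R_nonneg: "R l \<ge> 0" for l
    using \<alpha>[of l] by (simp add: R_def rpow_def)

  have w_sums: "w sums 1"
  proof -
    have "(\<lambda>l. m l / \<alpha> l) sums A"
      unfolding A_def using viii_1 by (intro summable_sums) (simp add: m_def \<alpha>_def T_def)
    from sums_divide[OF this, of A] show ?thesis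
      using A by (simp add: w_def[abs_def])
  qed
  have w_nonneg: "w l \<ge> 0" for l
    using m_nonneg \<alpha>[of l] A by (simp add: w_def)
  have w_le: "sum w I \<le> 1" if "finite I" for I
    using sum_le_suminf[OF sums_summable[OF w_sums] that] w_nonneg sums_unique[OF w_sums] by simp
  have lnL_sums: "(\<lambda>l. m l * ln (L l) / \<alpha> l) sums (\<Sum>l. m l * ln (L l) / \<alpha> l)"
    using viii_2 by (intro summable_sums) (simp add: m_def \<alpha>_def T_def L_def)
  have R_sums: "R sums (\<Sum>l. R l)"
    using viii_3 by (intro summable_sums) (simp add: m_def \<alpha>_def T_def R_def[abs_def])
  have E_sums: "E sums (1 * (P + ln Q) + (1 / A * (\<Sum>l. m l * ln (L l) / \<alpha> l) + D / A * (\<Sum>l. R l)))"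
    unfolding E_def[abs_def] by (intro sums_add sums_mult sums_mult2 w_sums lnL_sums R_sums)

  \<comment> \<open>Nonnegativity allows a finite sum over blocks to be enlarged to the full
    series.\<close>
  have K_nonneg: "K l \<ge> 0" for l
  proof -
    have "(2::real) powr 2 \<le> 2 powr (2 / \<epsilon> + 2)"
      using eps by (intro powr_mono) auto
    then have "4 * L l / \<Delta> \<le> Q * L l"
      using L(1)[of l] Delta_pos by (simp add: Q_def divide_right_mono mult_right_mono)
    moreover have "1 \<le> 4 * L l / \<Delta>"
      using L[of l] Delta_pos by simp
    ultimately have "0 \<le> ln (Q * L l)" by simp
    then show ?thesis
      using P D by (simp add: K_def)
  qed
  have E_pos: "E l = w l * K l" if "m l > 0" for l
  proof -
    have "m l * (c l / m l) powr (2 * \<gamma> / \<beta>) = c l powr (2 * \<gamma> / \<beta>) * rpow (m l) (1 - 2 * \<gamma> / \<beta>)"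
      using that c_pos by (simp add: rpow_def powr_divide powr_diff less_imp_le)
    then have "w l * (D * (c l / m l) powr (2 * \<gamma> / \<beta>)) = D / A * R l"
      by (simp add: w_def R_def mult_ac)
    moreover have "ln (Q * L l) = ln Q + ln (L l)"
      using Q L(1)[of l] by (simp add: ln_mult)
    ultimately show ?thesis
      unfolding K_def by (simp add: E_def distrib_left) (simp add: w_def)
  qed
  have E_zero: "E l = D / A * R l" if "m l = 0" for l
    using that by (simp add: E_def w_def)
  have E_nonneg: "E l \<ge> 0" for l
    using E_pos[of l] E_zero[of l] m_nonneg[of l] w_nonneg[of l] K_nonneg[of l] R_nonneg[of l] A D
    by (cases "m l = 0") auto

  \<comment> \<open>Hoelder's inequality over the blocks met by a finite set\<close>
  define B where "B = exp (suminf E)"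
  have finite_bound: "(\<integral>\<^sup>+\<omega>. (SUP t\<in>F. ennreal (exp (lam * (\<bar>X t \<omega>\<bar> / a (fst t))))) \<partial>M) \<le> ennreal B"
    if F: "finite F" "F \<subseteq> TDelta \<Delta>" for F
  proof -
    have "\<exists>l. t \<in> T l" if "t \<in> F" for t
      unfolding T_def using F that by (intro TDelta_subset_Tblocks b0 b_mono b_lim) auto
    then obtain \<tau> where \<tau>: "t \<in> T (\<tau> t)" if "t \<in> F" for t
      by metis
    \<comment> \<open>Blocks with \<open>m l = 0\<close> are left out: the process vanishes almost
      surely at their finitely many points in \<open>F\<close>.\<close>
    define I where "I = {l \<in> \<tau> ` F. m l > 0}"
    define G where "G l \<omega> = (MAX t\<in>F \<inter> T l. \<bar>X t \<omega>\<bar>)" for l \<omega>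
    have I: "finite I" using F by (simp add: I_def)
    have block: "finite (F \<inter> T l)" "F \<inter> T l \<noteq> {}" if "l \<in> I" for l
      using F that \<tau> by (auto simp: I_def)
    have G_ge: "\<bar>X t \<omega>\<bar> \<le> G l \<omega>" if "t \<in> F" "t \<in> T l" for t l \<omega>
      unfolding G_def using F that by (intro Max_ge) auto
    have G_nonneg: "0 \<le> G l \<omega>" if "l \<in> I" for l \<omega>
    proof -
      obtain t where "t \<in> F \<inter> T l" using block(2)[OF \<open>l \<in> I\<close>] by blast
      then show ?thesis using G_ge[of t l \<omega>] by auto
    qed
    have G_meas: "G l \<in> borel_measurable M" if "l \<in> I" for l
      unfolding G_def using block[OF that] F meas by (intro borel_measurable_Max) auto
    have "AE \<omega> in M. \<forall>t\<in>F. m (\<tau> t) = 0 \<longrightarrow> X t \<omega> = 0"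
    proof (rule AE_finite_allI[OF F(1)])
      fix t assume t: "t \<in> F"
      show "AE \<omega> in M. m (\<tau> t) = 0 \<longrightarrow> X t \<omega> = 0"
      proof (cases "m (\<tau> t) = 0")
        case True
        have "AE \<omega> in M. X t \<omega> = 0"
          using gaussian_process_value[OF gauss, of t] F t sd[OF \<tau>[OF t]] True
          by (intro gaussian_AE_zero[OF M]) auto
        then show ?thesis by simp
      qed simp
    qed
    then have "AE \<omega> in M. (SUP t\<in>F. ennreal (exp (lam * (\<bar>X t \<omega>\<bar> / a (fst t)))))
        \<le> ennreal (exp (\<Sum>l\<in>I. w l * (lam * A / m l * G l \<omega>)))"
    proof eventually_elim
      fix \<omega> assume zero: "\<forall>t\<in>F. m (\<tau> t) = 0 \<longrightarrow> X t \<omega> = 0"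
      have w_G: "w l * (lam * A / m l * G l \<omega>) = lam * (G l \<omega> / \<alpha> l)" if "l \<in> I" for l
        using that A by (simp add: w_def I_def)
      have term_nonneg: "0 \<le> lam * (G l \<omega> / \<alpha> l)" if "l \<in> I" for l
        using G_nonneg[OF that] \<alpha>[of l] lambda by simp
      have "lam * (\<bar>X t \<omega>\<bar> / a (fst t)) \<le> (\<Sum>l\<in>I. lam * (G l \<omega> / \<alpha> l))" if t: "t \<in> F" for t
      proof (cases "m (\<tau> t) = 0")
        case True
        then have "X t \<omega> = 0" using zero t by blast
        then show ?thesis
          using term_nonneg by (simp add: sum_nonneg)
      next
        case False
        then have l: "\<tau> t \<in> I" using t m_nonneg[of "\<tau> t"] by (simp add: I_def)
        have "b (\<tau> t) \<le> fst t" using \<tau>[OF t] by (simp add: T_def Tblock_def)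
        \<comment> \<open>Monotonicity of \<open>a\<close> replaces the varying weight by its value
          at the left end of the block.\<close>
        then have "\<alpha> (\<tau> t) \<le> a (fst t)"
          unfolding \<alpha>_def using b_nonneg[of "\<tau> t"] by (intro mono_onD[OF a_mono]) auto
        then have "\<bar>X t \<omega>\<bar> / a (fst t) \<le> G (\<tau> t) \<omega> / \<alpha> (\<tau> t)"
          using G_ge[OF t \<tau>[OF t]] G_nonneg[OF l] \<alpha>[of "\<tau> t"] by (intro frac_le) auto
        then have "lam * (\<bar>X t \<omega>\<bar> / a (fst t)) \<le> lam * (G (\<tau> t) \<omega> / \<alpha> (\<tau> t))"
          using lambda by (intro mult_left_mono) auto
        also have "\<dots> \<le> (\<Sum>l\<in>I. lam * (G l \<omega> / \<alpha> l))"
          using I l term_nonneg by (intro member_le_sum) auto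
        finally show ?thesis .
      qed
      moreover have "(\<Sum>l\<in>I. lam * (G l \<omega> / \<alpha> l)) = (\<Sum>l\<in>I. w l * (lam * A / m l * G l \<omega>))"
        by (intro sum.cong refl w_G[symmetric])
      ultimately show "(SUP t\<in>F. ennreal (exp (lam * (\<bar>X t \<omega>\<bar> / a (fst t)))))
        \<le> ennreal (exp (\<Sum>l\<in>I. w l * (lam * A / m l * G l \<omega>)))"
        by (intro SUP_least ennreal_leI) simp
    qed
    then have "(\<integral>\<^sup>+\<omega>. (SUP t\<in>F. ennreal (exp (lam * (\<bar>X t \<omega>\<bar> / a (fst t))))) \<partial>M)
        \<le> (\<integral>\<^sup>+\<omega>. ennreal (exp (\<Sum>l\<in>I. w l * (lam * A / m l * G l \<omega>))) \<partial>M)"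
      by (rule nn_integral_mono_AE)
    also have "\<dots> \<le> ennreal (exp (\<Sum>l\<in>I. w l * K l))"
    proof (intro nn_integral_exp_weighted_sum_le M I w_nonneg w_le[OF I])
      fix l assume l: "l \<in> I"
      show "(\<lambda>\<omega>. lam * A / m l * G l \<omega>) \<in> borel_measurable M"
        using G_meas[OF l] by simp
      have "m l > 0" using l by (simp add: I_def)
      show "(\<integral>\<^sup>+\<omega>. ennreal (exp (lam * A / m l * G l \<omega>)) \<partial>M) \<le> ennreal (exp (K l))"
        unfolding G_def K_def P_def Q_def D_def L_def
        using L[of l] block[OF l] sd[of _ l] vii lambda A c_pos \<open>m l > 0\<close>
        by (intro nn_integral_exp_Max_Tblock_le[OF gauss Delta_pos b_nonneg] beta gamma eps theta)
           (auto simp: T_def L_def)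
    qed
    also have "(\<Sum>l\<in>I. w l * K l) = (\<Sum>l\<in>I. E l)"
      by (intro sum.cong) (auto simp: I_def E_pos)
    also have "\<dots> \<le> suminf E"
      using E_nonneg by (intro sum_le_suminf I sums_summable[OF E_sums]) auto
    finally show ?thesis
      by (simp add: B_def)
  qed

  \<comment> \<open>From finite sets to the whole index set\<close>
  have a_fst: "continuous_on (TDelta \<Delta>) (\<lambda>t. a (fst t))"
    by (intro continuous_on_compose2[OF a_cont] continuous_intros) (auto simp: TDelta_def)
  obtain S where S: "S \<subseteq> TDelta \<Delta>" "countable S"
    and sup: "AE \<omega> in M. (SUP t\<in>TDelta \<Delta>. ennreal (exp (lam * (\<bar>X t \<omega>\<bar> / a (fst t)))))
        \<le> (SUP t\<in>S. ennreal (exp (lam * (\<bar>X t \<omega>\<bar> / a (fst t)))))"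
    by (rule separable_SUP_le[OF sep a_fst]) (use a_pos in \<open>auto simp: TDelta_def\<close>)
  have "(\<integral>\<^sup>+ \<omega>. (SUP t\<in>TDelta \<Delta>. ennreal (exp (lam * (\<bar>X t \<omega>\<bar> / a (fst t))))) \<partial>M)
      \<le> (\<integral>\<^sup>+ \<omega>. (SUP t\<in>S. ennreal (exp (lam * (\<bar>X t \<omega>\<bar> / a (fst t))))) \<partial>M)"
    by (rule nn_integral_mono_AE[OF sup])
  also have "\<dots> \<le> ennreal B"
  proof (rule nn_integral_countable_SUP_le[OF S(2)])
    fix t assume "t \<in> S"
    then have [measurable]: "X t \<in> borel_measurable M"
      using S(1) by (intro meas) blast
    show "(\<lambda>\<omega>. ennreal (exp (lam * (\<bar>X t \<omega>\<bar> / a (fst t))))) \<in> borel_measurable M"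
      by measurable
  next
    fix F assume "finite F" "F \<subseteq> S"
    then show "(\<integral>\<^sup>+\<omega>. (SUP t\<in>F. ennreal (exp (lam * (\<bar>X t \<omega>\<bar> / a (fst t))))) \<partial>M) \<le> ennreal B"
      using S(1) by (intro finite_bound) blast+
  qed
  \<comment> \<open>Since the weights sum to 1, \<open>P\<close> and \<open>ln Q\<close> enter the
    exponent exactly once.\<close>
  also have "B = exp (lam\<^sup>2 * A\<^sup>2 / (2 * (1 - \<theta>)\<^sup>2)) * (Q * exp (1 / A * (\<Sum>l. m l * ln (L l) / \<alpha> l))
      * exp (D / A * (\<Sum>l. R l)))"
    unfolding B_def sums_unique[OF E_sums, symmetric] P_def
    using Q by (simp add: exp_add power_mult_distrib mult_ac)
  also have "D / A = \<Delta> powr (2 * \<gamma>)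
      / (\<gamma> * A * (1 - \<epsilon> / \<beta>) powr (2 * \<gamma> / \<epsilon>) * \<theta> powr (2 * \<gamma> / \<beta>) * 4 powr (2 * \<gamma>))"
    by (simp add: D_def mult_ac)
  also have "R = (\<lambda>l. c l powr (2 * \<gamma> / \<beta>) * rpow (m l) (1 - 2 * \<gamma> / \<beta>) / \<alpha> l)"
    by (simp add: R_def fun_eq_iff mult.commute)
  finally show ?thesis
    unfolding Let_def A_def m_def \<alpha>_def Q_def L_def T_def .
qed

end
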